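(* Let $q$ be an odd prime power, $n\geq 3$ odd, $\xi$ a non-square in $\mathbb{F}_q$, $r$ an integer with $\gcd(n,r)=1$, and $b\in\mathbb{F}_{q^n}^*$ with $N_q(b)\neq\pm1$. Let $A_{b^2,r}(x)=x^{q^r}-b^2x^{q^{n-r}}$, $H_{b,-r}(x)=x-bx^{q^{n-r}}$ and $B_{b,-r}(x)=2H_{b,-r}^{-1}(x)-x$, and consider $$L_{\mathcal{D}_{AB}}=\{\langle(x,y,A_{b^2,r}(y),\xi B_{b,-r}(x))\rangle : x,y\in\mathbb{F}_{q^n},\ (x,y)\neq(0,0)\}\subset PG(3,q^n).$$ Then: (i) If $N_q(b^2)\neq-1$ and $n=3$, then $L_{\mathcal{D}_{AB}}$ is a maximum scattered $\mathbb{F}_q$-linear set of $PG(3,q^3)$ of pseudoregulus type. (ii) If $N_q(b^2)\neq-1$ and $n>3$, then $L_{\mathcal{D}_{AB}}$ is a maximum scattered $\mathbb{F}_q$-linear set of $PG(3,q^n)$, and the lines $X_1=X_2=0$ and $X_0=X_3=0$ are two long lines of it, one of which is of pseudoregulus type and the other is not. (iii) If $N_q(b^2)=-1$, then the points of $L_{\mathcal{D}_{AB}}$ of weight greater than one have weight $2$, there are $(q^{n-1}-1)/(q^2-1)$ of them, and $|L_{\mathcal{D}_{AB}}|=\frac{q^{2n+1}+q^{2n}-q^n-1}{q^2-1}$.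
   Context: $N_q$ denotes the norm from $\mathbb{F}_{q^n}$ to $\mathbb{F}_q$. For an $\mathbb{F}_q$-subspace $U$ of $\mathbb{F}_{q^n}^4$, $L_U=\{\langle\mathbf u\rangle:\mathbf u\in U\setminus\{0\}\}$ is an $\mathbb{F}_q$-linear set of rank $\dim_{\mathbb{F}_q}U$; the weight of a subspace $PG(W,\mathbb{F}_{q^n})$ in $L_U$ is $\dim_{\mathbb{F}_q}(W\cap U)$. $L_U$ is scattered if all its points have weight $1$, maximum scattered in $PG(3,q^n)$ if moreover its rank is $2n$; a long line is a line of weight $n$. A maximum scattered $L$ of $PG(3,q^n)$ is of pseudoregulus type if there exist $q^n+1$ pairwise disjoint long lines of $L$ and exactly two lines disjoint from $L$ meeting each of them. An $\mathbb{F}_q$-linear set of a projective line $PG(1,q^n)$ is of pseudoregulus type if it equals $\{\langle\lambda\mathbf w+\rho\lambda^\tau\mathbf v\rangle:\lambda\in\mathbb{F}_{q^n}^*\}$ for independent vectors $\mathbf w,\mathbf v$, some $\rho\in\mathbb{F}_{q^n}^*$ and an automorphism $\tau$ of $\mathbb{F}_{q^n}$ with fixed field $\mathbb{F}_q$; a line $r$ of $PG(3,q^n)$ is of pseudoregulus type (w.r.t. $L$) if $L\cap r$ is of pseudoregulus type as a linear set of $r$. *)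

theory Defs
  imports "HOL-Analysis.Analysis" "HOL-Number_Theory.Prime_Powers"
begin

text \<open>
  Throughout, the type \<open>'a\<close> is the field with \<open>q ^ n\<close> elements and its subfield with \<open>q\<close> elements
  is the set \<open>Fq q\<close>. Subspaces over \<open>'a\<close> are the library's \<open>vec.subspace\<close>; a point of \<open>PG(3,q^n)\<close> is a
  one-dimensional such subspace of \<open>'a ^ 4\<close>, a line a two-dimensional one.
\<close>

definition Fq :: "nat \<Rightarrow> 'a::{field,finite} set" where
  "Fq q = {x. x ^ q = x}"

subsection \<open>Linear algebra over the subfield\<close>

text \<open>The library's vector space notions take the scalars from a whole type, so those over \<open>Fq q\<close>
  are spelt out, following the explicit forms of \<open>span\<close>, \<open>dependent\<close> and the definition of \<open>dim\<close>.\<close>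

definition Fq_subspace :: "nat \<Rightarrow> ('a::{field,finite} ^ 'm) set \<Rightarrow> bool" where
  "Fq_subspace q U \<longleftrightarrow>
     0 \<in> U \<and> (\<forall>u\<in>U. \<forall>v\<in>U. u + v \<in> U) \<and> (\<forall>c\<in>Fq q. \<forall>u\<in>U. c *s u \<in> U)"

definition Fq_span :: "nat \<Rightarrow> ('a::{field,finite} ^ 'm) set \<Rightarrow> ('a ^ 'm) set" where
  "Fq_span q S =
     {(\<Sum>v\<in>T. c v *s v) | T c. finite T \<and> T \<subseteq> S \<and> (\<forall>v\<in>T. c v \<in> Fq q)}"

definition Fq_independent :: "nat \<Rightarrow> ('a::{field,finite} ^ 'm) set \<Rightarrow> bool" where
  "Fq_independent q S \<longleftrightarrow>
     (\<forall>T c. finite T \<and> T \<subseteq> S \<and> (\<forall>v\<in>T. c v \<in> Fq q) \<and> (\<Sum>v\<in>T. c v *s v) = 0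
        \<longrightarrow> (\<forall>v\<in>T. c v = 0))"

text \<open>Only meaningful for \<open>Fq q\<close>-subspaces, the only arguments it is applied to.\<close>

definition Fq_dim :: "nat \<Rightarrow> ('a::{field,finite} ^ 'm) set \<Rightarrow> nat" where
  "Fq_dim q U = card (SOME B. B \<subseteq> U \<and> Fq_independent q B \<and> Fq_span q B = U)"

subsection \<open>Linear sets of \<open>PG(3,q^n)\<close>\<close>

definition linear_set :: "('a::{field,finite} ^ 4) set \<Rightarrow> ('a ^ 4) set set" where
  "linear_set U = {vec.span {u} | u. u \<in> U - {0}}"

definition weight :: "nat \<Rightarrow> ('a::{field,finite} ^ 4) set \<Rightarrow> ('a ^ 4) set \<Rightarrow> nat" where
  "weight q U W = Fq_dim q (W \<inter> U)"

definition scattered :: "nat \<Rightarrow> ('a::{field,finite} ^ 4) set \<Rightarrow> bool" where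
  "scattered q U \<longleftrightarrow> Fq_subspace q U \<and> (\<forall>P\<in>linear_set U. weight q U P = 1)"

definition maximum_scattered :: "nat \<Rightarrow> nat \<Rightarrow> ('a::{field,finite} ^ 4) set \<Rightarrow> bool" where
  "maximum_scattered q n U \<longleftrightarrow> scattered q U \<and> Fq_dim q U = 2 * n"

definition is_line :: "('a::{field,finite} ^ 4) set \<Rightarrow> bool" where
  "is_line l \<longleftrightarrow> vec.subspace l \<and> vec.dim l = 2"

definition long_line :: "nat \<Rightarrow> nat \<Rightarrow> ('a::{field,finite} ^ 4) set \<Rightarrow> ('a ^ 4) set \<Rightarrow> bool" where
  "long_line q n U l \<longleftrightarrow> is_line l \<and> weight q U l = n"

text \<open>Two lines are disjoint as point sets iff the subspaces meet only in \<open>0\<close>.\<close>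

definition lines_meet :: "('a::{field,finite} ^ 4) set \<Rightarrow> ('a ^ 4) set \<Rightarrow> bool" where
  "lines_meet l m \<longleftrightarrow> l \<inter> m \<noteq> {0}"

definition points_on :: "('a::{field,finite} ^ 4) set set \<Rightarrow> ('a ^ 4) set \<Rightarrow> ('a ^ 4) set set" where
  "points_on L l = {P \<in> L. P \<subseteq> l}"

definition pseudoregulus_type :: "nat \<Rightarrow> nat \<Rightarrow> ('a::{field,finite} ^ 4) set \<Rightarrow> bool" where
  "pseudoregulus_type q n U \<longleftrightarrow>
     maximum_scattered q n U \<and>
     (\<exists>S. card S = q ^ n + 1 \<and>
          (\<forall>s\<in>S. long_line q n U s) \<and>
          (\<forall>s\<in>S. \<forall>s'\<in>S. s \<noteq> s' \<longrightarrow> \<not> lines_meet s s') \<and>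
          card {t. is_line t \<and> points_on (linear_set U) t = {} \<and> (\<forall>s\<in>S. lines_meet t s)} = 2)"

definition automorphism_fixing :: "nat \<Rightarrow> ('a::{field,finite} \<Rightarrow> 'a) \<Rightarrow> bool" where
  "automorphism_fixing q \<tau> \<longleftrightarrow>
     bij \<tau> \<and> (\<forall>x y. \<tau> (x + y) = \<tau> x + \<tau> y) \<and> (\<forall>x y. \<tau> (x * y) = \<tau> x * \<tau> y) \<and>
     {x. \<tau> x = x} = Fq q"

text \<open>The vectors \<open>w\<close>, \<open>v\<close> are taken in the underlying space of the line \<open>l\<close>.\<close>

definition pseudoregulus_type_line ::
  "nat \<Rightarrow> ('a::{field,finite} ^ 4) set set \<Rightarrow> ('a ^ 4) set \<Rightarrow> bool" where
  "pseudoregulus_type_line q L l \<longleftrightarrow>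
     is_line l \<and>
     (\<exists>w\<in>l. \<exists>v\<in>l. \<exists>\<rho> \<tau>.
        w \<noteq> v \<and> vec.independent {w, v} \<and> \<rho> \<noteq> 0 \<and> automorphism_fixing q \<tau> \<and>
        points_on L l = {vec.span {z *s w + (\<rho> * \<tau> z) *s v} | z. z \<noteq> 0})"

subsection \<open>The linear set under consideration\<close>

definition Nq :: "nat \<Rightarrow> nat \<Rightarrow> 'a::{field,finite} \<Rightarrow> 'a" where
  "Nq q n x = (\<Prod>i<n. x ^ (q ^ i))"

text \<open>\<open>frob q n s x\<close> is \<open>x ^ (q ^ s)\<close> for an integer \<open>s\<close>. As \<open>x ^ (q ^ n) = x\<close> on a field with
  \<open>q ^ n\<close> elements, \<open>s\<close> is reduced modulo \<open>n\<close>, which also covers negative \<open>s\<close>.\<close>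

definition frob :: "nat \<Rightarrow> nat \<Rightarrow> int \<Rightarrow> 'a::{field,finite} \<Rightarrow> 'a" where
  "frob q n s x = x ^ (q ^ nat (s mod int n))"

definition A_map :: "nat \<Rightarrow> nat \<Rightarrow> 'a::{field,finite} \<Rightarrow> int \<Rightarrow> 'a \<Rightarrow> 'a" where
  "A_map q n a r x = frob q n r x - a * frob q n (int n - r) x"

text \<open>\<open>H_map q n b r\<close> and \<open>B_map q n b r\<close> render \<open>H\<close> and \<open>B\<close> with subscript \<open>b, -r\<close>. When \<open>b\<close> has
  norm different from \<open>1\<close>, \<open>H_map q n b r\<close> is a bijection, so that \<open>inv\<close> is its inverse.\<close>

definition H_map :: "nat \<Rightarrow> nat \<Rightarrow> 'a::{field,finite} \<Rightarrow> int \<Rightarrow> 'a \<Rightarrow> 'a" where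
  "H_map q n b r x = x - b * frob q n (int n - r) x"

definition B_map :: "nat \<Rightarrow> nat \<Rightarrow> 'a::{field,finite} \<Rightarrow> int \<Rightarrow> 'a \<Rightarrow> 'a" where
  "B_map q n b r x = 2 * inv (H_map q n b r) x - x"

text \<open>The coordinates \<open>X\<^sub>0, \<dots>, X\<^sub>3\<close> are the components \<open>$ 1, \<dots>, $ 4\<close>.\<close>

definition U_AB :: "nat \<Rightarrow> nat \<Rightarrow> int \<Rightarrow> 'a::{field,finite} \<Rightarrow> 'a \<Rightarrow> ('a ^ 4) set" where
  "U_AB q n r b \<xi> = {vector [x, y, A_map q n (b\<^sup>2) r y, \<xi> * B_map q n b r x] | x y. True}"

lemma vector_4:
  "(vector [x, y, z, w] :: 'a::zero ^ 4) $ 1 = x" "(vector [x, y, z, w] :: 'a ^ 4) $ 2 = y"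
  "(vector [x, y, z, w] :: 'a ^ 4) $ 3 = z" "(vector [x, y, z, w] :: 'a ^ 4) $ 4 = w"
  by (simp_all add: vector_def)

definition line_X1_X2 :: "('a::{field,finite} ^ 4) set" where
  "line_X1_X2 = {u. u $ 2 = 0 \<and> u $ 3 = 0}"

definition line_X0_X3 :: "('a::{field,finite} ^ 4) set" where
  "line_X0_X3 = {u. u $ 1 = 0 \<and> u $ 4 = 0}"

end

theory Submission
  imports Defs
begin

text \<open>
  Write \<open>\<sigma>\<close> for \<open>x \<mapsto> x ^ (q ^ r)\<close>. The substitution \<open>x = H u\<close> turns \<open>(x, \<xi> B x)\<close> into
  \<open>u (1, \<xi>) + b \<sigma>\<^sup>-\<^sup>1(u) (-1, \<xi>)\<close>, so the line \<open>X\<^sub>1 = X\<^sub>2 = 0\<close> is of pseudoregulus type and only vectors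
  with \<open>x = 0\<close> can lie on a point of weight above one. On \<open>X\<^sub>0 = X\<^sub>3 = 0\<close> the equation
  \<open>A (c y) = c A y\<close> reads \<open>\<sigma>(\<mu>) \<sigma>(y) = - b\<^sup>2 \<mu> \<sigma>\<^sup>-\<^sup>1(y)\<close> with \<open>\<mu> = c - \<sigma>\<^sup>-\<^sup>1(c)\<close>. Taking norms shows that
  \<open>\<mu> = 0\<close> unless \<open>N(b\<^sup>2) = -1\<close>. In the latter case \<open>- b\<^sup>2 = \<sigma>(c\<^sub>0) / c\<^sub>0\<close> by Hilbert 90, and the point given by
  \<open>y\<close> has weight two iff the quadratic form \<open>z \<mapsto> Tr (c\<^sub>0 z \<sigma>\<^sup>-\<^sup>1(z))\<close> vanishes at \<open>1 / y\<close>. This form is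
  nondegenerate of odd rank \<open>n\<close>, so it has \<open>q ^ (n - 1)\<close> zeros.

  For \<open>n = 3\<close> the line \<open>X\<^sub>0 = X\<^sub>3 = 0\<close> has a parametrization \<open>z w + \<sigma>\<^sup>-\<^sup>1(z) v\<close> as well, and the two
  lines together form a pseudoregulus. For \<open>n > 3\<close> such a parametrization is excluded by power
  sums of the slopes \<open>A y / y\<close>.
\<close>

subsection \<open>Finite fields, norm and Hilbert 90\<close>

text \<open>The oddness of \<open>n\<close> enters through \<open>Nq q n (- x) = - Nq q n x\<close>:
  for the trace form, a nonzero radical vector would produce a nonzero norm equal to its own
  negative. Excluding a pseudoregulus on \<open>X\<^sub>0 = X\<^sub>3 = 0\<close> meets an obstacle:
  an equality of point sets does not relate the parameters, so the unknown automorphism and vectors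
  are not tied to \<sigma>. Only the set of slopes is shared. On each side every slope comes from
  exactly \<open>q - 1\<close> nonzero parameters, so sums over slopes become sums over the field,
  where a quotient of two different powers sums to 0. The exponent \<open>1 + q ^ j\<close> then
  isolates a product of the coefficients with indices \<open>j\<close> and \<open>n - j\<close>. In
  \<open>A\<close> only the residues of \<open>r\<close> and \<open>- r\<close> modulo
  \<open>n\<close> occur as indices, whereas a pseudoregulus leads either to at most one positive
  index, 1 or \<open>n - 1\<close>, or to all positive indices at once. For \<open>n = 3\<close> the
  indices 1 and 2 are all the positive ones, so no contradiction arises.\<close>

lemma sum_comp_fibres:
  fixes g :: "'b \<Rightarrow> 'c::semiring_1"
  assumes "finite A" and "\<And>x. x \<in> A \<Longrightarrow> card {z \<in> A. f z = f x} = m"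
  shows "(\<Sum>x\<in>A. g (f x)) = of_nat m * (\<Sum>y\<in>f ` A. g y)"
proof -
  have "(\<Sum>x\<in>A. g (f x)) = (\<Sum>y\<in>f ` A. \<Sum>z\<in>{z \<in> A. f z = y}. g (f z))"
    by (rule sum.image_gen[OF assms(1)])
  also have "\<dots> = (\<Sum>y\<in>f ` A. of_nat m * g y)"
    by (rule sum.cong) (use assms(2) in auto)
  finally show ?thesis by (simp add: sum_distrib_left)
qed

lemma card_eq_card_image_times:
  assumes "finite A" and "\<And>x. x \<in> A \<Longrightarrow> card {z \<in> A. f z = f x} = m"
  shows "card A = card (f ` A) * m"
  using sum_comp_fibres[OF assms, of "\<lambda>_. 1 :: nat"] by simp

lemma card_power_eq_le:
  fixes c :: "'a::{field,finite}"
  assumes "b < a"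
  shows "card {x. x ^ a = c * x ^ b} \<le> a"
proof -
  let ?p = "monom 1 a - monom c b"
  have "coeff ?p a = 1" using assms by simp
  then have "?p \<noteq> 0" by (metis coeff_0 zero_neq_one)
  then have "card {x. poly ?p x = 0} \<le> degree ?p"
    by (rule card_poly_roots_bound)
  also have "\<dots> \<le> a"
    by (rule degree_diff_le) (use degree_monom_le[of c b] degree_monom_le[of "1::'a" a] assms in auto)
  finally show ?thesis by (simp add: poly_monom)
qed

text \<open>The parameter \<open>ty\<close> carries the type \<open>'a\<close>, which no other
  parameter mentions, so that the whole context speaks of one fixed field.\<close>

locale finite_field_ext =
  fixes q n :: nat and ty :: "'a::{field,finite} itself"
  assumes primepow_q: "primepow q" and odd_q: "odd q"
    and n_ge: "n \<ge> 3" and odd_n: "odd n"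
    and card_UNIV_eq: "CARD('a) = q ^ n"
begin

lemma q_ge: "q \<ge> 3"
proof -
  have "q > Suc 0" using primepow_q by (rule primepow_gt_Suc_0)
  moreover have "q \<noteq> 2" using odd_q by auto
  ultimately show ?thesis by simp
qed

lemma prime_CHAR: "prime CHAR('a)" and q_power_CHAR: "\<exists>e. q = CHAR('a) ^ e"
proof -
  \<comment> \<open>Translation by 1 permutes the field, so the sum of all elements does not change
    when \<open>CARD('a)\<close> is added to it. Hence the characteristic divides
    \<open>q ^ n\<close>.\<close>
  have "(\<Sum>x\<in>(UNIV::'a set). x) = (\<Sum>x\<in>UNIV. x + 1)"
    by (rule sum.reindex_bij_witness[of _ "\<lambda>x. x + 1" "\<lambda>x. x - 1"]) auto
  then have "of_nat CARD('a) = (0::'a)" by (simp add: sum.distrib)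
  then have dvd: "CHAR('a) dvd q ^ n"
    by (simp only: of_nat_eq_0_iff_char_dvd card_UNIV_eq)
  have "CHAR('a) > 0" by (simp add: finite_imp_CHAR_pos)
  then show pr: "prime CHAR('a)" by (rule prime_CHAR_semidom)
  obtain p e where pe: "prime p" "q = p ^ e"
    using primepow_q by (auto simp: primepow_def)
  have "CHAR('a) dvd p" using dvd pr unfolding pe(2) by (metis prime_dvd_power)
  then have "CHAR('a) = p" using pr pe(1) primes_dvd_imp_eq by blast
  then show "\<exists>e. q = CHAR('a) ^ e" using pe by auto
qed

lemma two_neq_0: "(2::'a) \<noteq> 0"
proof
  assume "(2::'a) = 0"
  then have "of_nat 2 = (0::'a)" by simp
  then have "CHAR('a) dvd 2" by (simp only: of_nat_eq_0_iff_char_dvd)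
  then have "CHAR('a) = 2" using prime_CHAR primes_dvd_imp_eq two_is_prime_nat by blast
  moreover obtain e where "q = CHAR('a) ^ e" using q_power_CHAR by blast
  ultimately show False using odd_q q_ge by (cases e) auto
qed

lemma eq_minus_iff: "(x::'a) = - x \<longleftrightarrow> x = 0"
proof
  assume "x = - x"
  then have "2 * x = 0" by (metis mult_2 add.right_inverse)
  then show "x = 0" using two_neq_0 by simp
qed simp

lemma frob_add: "(x + y :: 'a) ^ (q ^ i) = x ^ (q ^ i) + y ^ (q ^ i)"
proof -
  obtain e where "q = CHAR('a) ^ e" using q_power_CHAR by blast
  then show ?thesis
    using prime_CHAR by (intro freshmans_dream'[where n = "e * i"]) (simp_all add: power_mult)
qed

lemma frob_sum: "(sum f A :: 'a) ^ (q ^ i) = (\<Sum>a\<in>A. f a ^ (q ^ i))"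
  using q_ge by (induction A rule: infinite_finite_induct) (auto simp: frob_add)

lemma frob_minus: "(- x :: 'a) ^ (q ^ i) = - (x ^ (q ^ i))"
  using odd_q by simp

lemma frob_diff: "(x - y :: 'a) ^ (q ^ i) = x ^ (q ^ i) - y ^ (q ^ i)"
  using frob_add[of x "- y" i] by (simp add: frob_minus)

lemma frob_inject: "(x::'a) ^ (q ^ i) = y ^ (q ^ i) \<longleftrightarrow> x = y"
proof
  assume "x ^ (q ^ i) = y ^ (q ^ i)"
  then have "(x - y) ^ (q ^ i) = 0" by (simp add: frob_diff)
  then show "x = y" by simp
qed simp

lemma frob_frob: "((x::'a) ^ (q ^ i)) ^ (q ^ j) = x ^ (q ^ (i + j))"
  by (simp add: power_add power_mult)

text \<open>Multiplication by a nonzero \<open>x\<close> permutes the nonzero elements; comparing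
  their products gives \<open>x ^ (q ^ n - 1) = 1\<close>.\<close>

lemma frob_n [simp]: "(x::'a) ^ (q ^ n) = x"
proof (cases "x = 0")
  case False
  have "(\<Prod>y\<in>UNIV-{0}. y) = (\<Prod>y\<in>UNIV-{0}. x * y)"
    by (rule prod.reindex_bij_witness[of _ "\<lambda>y. x * y" "\<lambda>y. y / x"]) (use False in auto)
  also have "\<dots> = x ^ (CARD('a) - 1) * (\<Prod>y\<in>UNIV-{0}. y)"
    by (simp add: prod.distrib)
  finally have "x ^ (q ^ n - 1) = 1" by (simp add: card_UNIV_eq)
  then have "x ^ Suc (q ^ n - 1) = x" by (simp only: power_Suc mult_1_right)
  moreover have "q ^ n > 0" using q_ge by simp
  ultimately show ?thesis by (simp only: Suc_diff_1)
qed (use q_ge in simp)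

lemma frob_mod: "(x::'a) ^ (q ^ (i mod n)) = x ^ (q ^ i)"
proof (induction i rule: less_induct)
  case (less i)
  show ?case
  proof (cases "i < n")
    case False
    then have "x ^ (q ^ i) = (x ^ (q ^ n)) ^ (q ^ (i - n))" by (subst frob_frob) simp
    then have "x ^ (q ^ i) = x ^ (q ^ (i - n))" by simp
    moreover have "i mod n = (i - n) mod n" using False by (simp add: le_mod_geq)
    ultimately show ?thesis using less.IH[of "i - n"] False n_ge by simp
  qed simp
qed

section \<open>The subfield and the norm\<close>

lemma Fq_0: "(0::'a) \<in> Fq q" and Fq_1: "(1::'a) \<in> Fq q"
  using q_ge by (auto simp: Fq_def)

lemma Fq_add: "x \<in> Fq q \<Longrightarrow> y \<in> Fq q \<Longrightarrow> (x + y :: 'a) \<in> Fq q"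
  using frob_add[of x y 1] by (simp add: Fq_def)

lemma Fq_minus: "x \<in> Fq q \<Longrightarrow> (- x :: 'a) \<in> Fq q"
  using odd_q by (simp add: Fq_def)

lemma Fq_diff: "x \<in> Fq q \<Longrightarrow> y \<in> Fq q \<Longrightarrow> (x - y :: 'a) \<in> Fq q"
  using frob_diff[of x y 1] by (simp add: Fq_def)

lemma Fq_mult: "x \<in> Fq q \<Longrightarrow> y \<in> Fq q \<Longrightarrow> (x * y :: 'a) \<in> Fq q"
  by (simp add: Fq_def power_mult_distrib)

lemma Fq_divide: "x \<in> Fq q \<Longrightarrow> y \<in> Fq q \<Longrightarrow> (x / y :: 'a) \<in> Fq q"
  by (simp add: Fq_def power_divide)

lemma Fq_inverse: "x \<in> Fq q \<Longrightarrow> (inverse x :: 'a) \<in> Fq q"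
  by (simp add: Fq_def power_inverse)

lemma Fq_frob: "(x::'a) \<in> Fq q \<Longrightarrow> x ^ (q ^ i) = x"
  by (induction i) (auto simp: Fq_def power_mult)

lemma Nq_mult: "Nq q n (x * y :: 'a) = Nq q n x * Nq q n y"
  by (simp add: Nq_def power_mult_distrib prod.distrib)

lemma Nq_divide: "Nq q n (x / y :: 'a) = Nq q n x / Nq q n y"
  by (simp add: Nq_def power_divide prod_dividef)

lemma Nq_1 [simp]: "Nq q n (1 :: 'a) = 1"
  by (simp add: Nq_def)

lemma Nq_eq_0_iff [simp]: "Nq q n (x :: 'a) = 0 \<longleftrightarrow> x = 0"
  using n_ge q_ge by (auto simp: Nq_def intro!: exI[of _ 0])

lemma Nq_minus: "Nq q n (- x :: 'a) = - Nq q n x"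
  using odd_n by (simp add: Nq_def frob_minus prod_uminus)

lemma Nq_power: "Nq q n (x ^ m :: 'a) = Nq q n x ^ m"
  by (simp add: Nq_def prod_power_distrib power_commutes flip: power_mult) (simp add: mult.commute)

lemma Nq_in_Fq: "Nq q n (x :: 'a) \<in> Fq q"
proof -
  obtain m where m: "n = Suc m" using n_ge by (cases n) auto
  have "Nq q n x ^ q = (\<Prod>i<n. x ^ (q ^ Suc i))"
    by (simp add: Nq_def prod_power_distrib flip: power_mult) (simp add: mult.commute)
  also have "\<dots> = (\<Prod>i<m. x ^ (q ^ Suc i)) * x ^ (q ^ n)"
    unfolding m by simp
  also have "\<dots> = x ^ (q ^ 0) * (\<Prod>i<m. x ^ (q ^ Suc i))" by simp
  also have "\<dots> = Nq q n x"
    unfolding Nq_def m by (rule prod.lessThan_Suc_shift[symmetric])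
  finally show ?thesis by (simp add: Fq_def)
qed

lemma Nq_frob: "Nq q n (x ^ (q ^ i) :: 'a) = Nq q n x"
  by (simp add: Nq_power Fq_frob Nq_in_Fq)

lemma Nq_eq_power: "Nq q n (x :: 'a) = x ^ (\<Sum>i<n. q ^ i)"
  by (simp add: Nq_def power_sum)

lemma sum_q_powers: "(\<Sum>i<m. q ^ i) * (q - 1) = q ^ m - 1"
  by (induction m) (use q_ge in \<open>auto simp: algebra_simps diff_mult_distrib2\<close>)

lemma sum_q_powers_pos: "(\<Sum>i<n. q ^ i) > 0"
  using n_ge q_ge by (intro sum_pos) (auto simp: lessThan_empty_iff)

lemma card_Nq_fibre_le: "card {x::'a. Nq q n x = c} \<le> (\<Sum>i<n. q ^ i)"
  using card_power_eq_le[OF sum_q_powers_pos, of c] by (simp add: Nq_eq_power)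

text \<open>The roots of \<open>X ^ q - X\<close> give the upper bound. For the lower bound, the
  norm maps the \<open>q ^ n - 1\<close> nonzero elements to nonzero elements of
  \<open>Fq q\<close>, and its fibres have at most \<open>(q ^ n - 1) div (q - 1)\<close> elements,
  so at least \<open>q - 1\<close> values are needed.\<close>

lemma card_Fq: "card (Fq q :: 'a set) = q"
proof (rule antisym)
  have "{x::'a. x ^ q = x} = {x. x ^ q = 1 * x ^ 1}" by simp
  then show "card (Fq q :: 'a set) \<le> q"
    using card_power_eq_le[of 1 q "1::'a"] q_ge by (auto simp: Fq_def)
  have "UNIV - {0::'a} = (\<Union>c\<in>Fq q - {0}. {x. Nq q n x = c})"
    using Nq_in_Fq by auto
  then have "card (UNIV - {0::'a}) \<le> (\<Sum>c\<in>(Fq q - {0::'a}). card {x. Nq q n x = c})"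
    by (simp add: card_UN_le)
  also have "\<dots> \<le> (\<Sum>c\<in>(Fq q - {0::'a}). (\<Sum>i<n. q ^ i))"
    by (intro sum_mono card_Nq_fibre_le)
  finally have "(\<Sum>i<n. q ^ i) * (q - 1) \<le> (\<Sum>i<n. q ^ i) * (card (Fq q :: 'a set) - 1)"
    unfolding sum_q_powers using Fq_0 by (simp add: card_UNIV_eq mult.commute)
  then have "q - 1 \<le> card (Fq q :: 'a set) - 1"
    using sum_q_powers_pos by (simp only: mult_le_cancel1)
  moreover have "card (Fq q :: 'a set) > 0" using Fq_0 by (auto simp: card_gt_0_iff)
  ultimately show "q \<le> card (Fq q :: 'a set)" by linarith
qed

section \<open>Automorphisms with fixed field \<open>Fq q\<close>, and their quotients\<close>

lemma automorphism_fixing_0_1: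
  assumes "automorphism_fixing q (\<tau>::'a \<Rightarrow> 'a)"
  shows "\<tau> 0 = 0" "\<tau> 1 = 1"
  using assms Fq_0 Fq_1 unfolding automorphism_fixing_def by blast+

lemma automorphism_fixing_eq_0_iff:
  assumes "automorphism_fixing q (\<tau>::'a \<Rightarrow> 'a)"
  shows "\<tau> x = 0 \<longleftrightarrow> x = 0"
  using assms automorphism_fixing_0_1[OF assms]
  unfolding automorphism_fixing_def by (metis bij_is_inj injD)

lemma automorphism_fixing_divide:
  assumes "automorphism_fixing q (\<tau>::'a \<Rightarrow> 'a)"
  shows "\<tau> (x / y) = \<tau> x / \<tau> y"
proof (cases "y = 0")
  case False
  then have "\<tau> x = \<tau> (x / y) * \<tau> y"
    using assms unfolding automorphism_fixing_def by (metis nonzero_eq_divide_eq)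
  then show ?thesis
    using False automorphism_fixing_eq_0_iff[OF assms] by (simp add: divide_simps)
qed (simp add: automorphism_fixing_0_1[OF assms])

lemma automorphism_fixing_Nq:
  assumes "automorphism_fixing q (\<tau>::'a \<Rightarrow> 'a)"
  shows "Nq q n (\<tau> x) = Nq q n x"
proof -
  have mult: "\<tau> (x * y) = \<tau> x * \<tau> y" for x y
    using assms unfolding automorphism_fixing_def by blast
  have pow: "\<tau> (x ^ m) = \<tau> x ^ m" for x m
    by (induction m) (auto simp: automorphism_fixing_0_1[OF assms] mult)
  have "Nq q n (\<tau> x) = \<tau> (Nq q n x)" by (simp add: Nq_eq_power pow)
  also have "\<dots> = Nq q n x"
    using Nq_in_Fq assms unfolding automorphism_fixing_def by blast
  finally show ?thesis .
qed

lemma automorphism_fixing_quotient_eq_iff: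
  assumes "automorphism_fixing q (\<tau>::'a \<Rightarrow> 'a)" "y \<noteq> 0" "x \<noteq> 0"
  shows "\<tau> x / x = \<tau> y / y \<longleftrightarrow> x / y \<in> Fq q"
proof -
  have "x / y \<in> Fq q \<longleftrightarrow> \<tau> (x / y) = x / y"
    using assms(1) unfolding automorphism_fixing_def by blast
  also have "\<dots> \<longleftrightarrow> \<tau> x / \<tau> y = x / y"
    by (simp add: automorphism_fixing_divide[OF assms(1)])
  also have "\<dots> \<longleftrightarrow> \<tau> x / x = \<tau> y / y"
    using assms(2,3) automorphism_fixing_eq_0_iff[OF assms(1)] by (auto simp: field_simps)
  finally show ?thesis by blast
qed

lemma card_automorphism_quotient_fibre:
  assumes "automorphism_fixing q (\<tau>::'a \<Rightarrow> 'a)" "y \<noteq> 0"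
  shows "card {x \<in> UNIV - {0}. \<tau> x / x = \<tau> y / y} = q - 1"
proof -
  have "bij_betw (\<lambda>c. c * y) (Fq q - {0}) {x \<in> UNIV - {0}. \<tau> x / x = \<tau> y / y}"
    by (rule bij_betw_byWitness[where f' = "\<lambda>x. x / y"])
      (use assms in \<open>auto simp: automorphism_fixing_quotient_eq_iff\<close>)
  then have "card {x \<in> UNIV - {0}. \<tau> x / x = \<tau> y / y} = card (Fq q - {0::'a})"
    by (rule bij_betw_same_card[symmetric])
  then show ?thesis using Fq_0 by (simp add: card_Fq)
qed

text \<open>Hilbert 90, by counting: both sides have \<open>(q ^ n - 1) div (q - 1)\<close> elements.\<close>

lemma automorphism_quotients_eq_norm_1:
  assumes "automorphism_fixing q (\<tau>::'a \<Rightarrow> 'a)"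
  shows "(\<lambda>z. \<tau> z / z) ` (UNIV - {0}) = {x. Nq q n x = 1}"
proof (rule card_seteq)
  show "(\<lambda>z. \<tau> z / z) ` (UNIV - {0}) \<subseteq> {x. Nq q n x = 1}"
    by (auto simp: Nq_divide automorphism_fixing_Nq[OF assms])
  have "card (UNIV - {0::'a}) = card ((\<lambda>z. \<tau> z / z) ` (UNIV - {0})) * (q - 1)"
    by (rule card_eq_card_image_times)
      (use card_automorphism_quotient_fibre[OF assms] in auto)
  then have "(\<Sum>i<n. q ^ i) * (q - 1) = card ((\<lambda>z. \<tau> z / z) ` (UNIV - {0})) * (q - 1)"
    unfolding sum_q_powers by (simp add: card_UNIV_eq)
  then have "(\<Sum>i<n. q ^ i) = card ((\<lambda>z. \<tau> z / z) ` (UNIV - {0}))"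
    using q_ge by (simp only: mult_cancel2) simp
  then show "card {x::'a. Nq q n x = 1} \<le> card ((\<lambda>z. \<tau> z / z) ` (UNIV - {0}))"
    using card_Nq_fibre_le[of 1] by simp
qed simp

lemma automorphism_fixing_frob:
  assumes "coprime k n" 
  shows "automorphism_fixing q (\<lambda>x::'a. x ^ (q ^ k))"
  unfolding automorphism_fixing_def
proof (intro conjI allI)
  have "inj (\<lambda>x::'a. x ^ (q ^ k))" by (auto simp: inj_def frob_inject)
  then show "bij (\<lambda>x::'a. x ^ (q ^ k))" by (simp add: bij_def finite_UNIV_inj_surj)
  show "{x::'a. x ^ (q ^ k) = x} = Fq q"
  proof (intro subset_antisym subsetI)
    fix x :: 'a assume "x \<in> {x. x ^ (q ^ k) = x}"
    then have x: "x ^ (q ^ k) = x" by simp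
    have iter: "x ^ (q ^ (k * m)) = x" for m
    proof (induction m)
      case (Suc m)
      have "x ^ (q ^ (k * Suc m)) = (x ^ (q ^ k)) ^ (q ^ (k * m))" by (subst frob_frob) simp
      then show ?case using x Suc by simp
    qed simp
    have "k \<noteq> 0" using assms n_ge by (intro notI) simp
    \<comment> \<open>By Bezout some multiple of \<open>k\<close> is 1 modulo \<open>n\<close>, so
      iterating the \<open>k\<close>-th Frobenius power yields \<open>x ^ q\<close>. An element
      fixed by the former is therefore fixed by the latter.\<close>
    then obtain a b where "a * k = b * n + 1"
      using bezout_nat[of k n] assms by (auto simp: mult.commute)
    then have "k * a = 1 + b * n" by (simp add: mult.commute)
    then have "(k * a) mod n = 1 mod n" by (simp only: mod_mult_self1)
    then have "x ^ (q ^ (k * a)) = x ^ (q ^ 1)" by (metis frob_mod)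
    then have "x ^ (q ^ 1) = x" using iter[of a] by simp
    then show "x \<in> Fq q" by (simp add: Fq_def)
  qed (simp add: Fq_frob)
qed (auto simp: frob_add power_mult_distrib)

end

subsection \<open>Subspaces over the subfield, points and lines\<close>

lemma span_singleton_eq: "vec.span {u :: 'a::field ^ 'm} = range (\<lambda>c. c *s u)"
  by (auto simp: vec.span_singleton)

lemma span_pair_eq: "vec.span {u, v :: 'a::field ^ 'm} = {c *s u + d *s v | c d. True}"
proof -
  have "x \<in> vec.span {u, v} \<longleftrightarrow> (\<exists>c d. x = c *s u + d *s v)" for x
  proof -
    have "x \<in> vec.span {u, v} \<longleftrightarrow> (\<exists>c d. x - c *s u = d *s v)"
      by (auto simp: vec.span_insert vec.span_singleton)
    also have "\<dots> \<longleftrightarrow> (\<exists>c d. x = c *s u + d *s v)" by (simp add: algebra_simps)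
    finally show ?thesis .
  qed
  then show ?thesis by blast
qed

lemma independent_pair_iff:
  fixes u v :: "'a::field ^ 'm"
  shows "u \<noteq> v \<and> vec.independent {u, v} \<longleftrightarrow> (\<forall>c d. c *s u + d *s v = 0 \<longrightarrow> c = 0 \<and> d = 0)"
proof (intro iffI conjI allI impI)
  fix c d assume *: "u \<noteq> v \<and> vec.independent {u, v}" and eq: "c *s u + d *s v = 0"
  define f where "f w = (if w = u then c else d)" for w
  have "(\<Sum>w\<in>{u, v}. f w *s w) = 0" using * eq by (auto simp: f_def)
  then have "f w = 0" if "w \<in> {u, v}" for w
    using * that by (intro vec.independentD[of "{u, v}" "{u, v}" f]) auto
  then show "c = 0" "d = 0" using * by (force simp: f_def)+
next
  assume *: "\<forall>c d. c *s u + d *s v = 0 \<longrightarrow> c = 0 \<and> d = 0"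
  show "u \<noteq> v" using *[rule_format, of 1 "-1"] by auto
  show "vec.independent {u, v}"
  proof -
    have "v \<noteq> 0" using *[rule_format, of 0 1] by auto
    moreover have "u \<notin> vec.span {v}"
      unfolding vec.span_singleton using *[rule_format, of 1 "- c" for c] by auto
    ultimately show ?thesis by (simp add: vec.independent_insert)
  qed
qed

lemma is_line_spanI:
  assumes "\<And>c d. c *s u + d *s v = 0 \<Longrightarrow> c = 0 \<and> d = 0"
  shows "is_line (vec.span {u, v})"
proof -
  have "u \<noteq> v" "vec.independent {u, v}" using assms independent_pair_iff by blast+
  then show ?thesis by (simp add: is_line_def vec.dim_eq_card_independent)
qed

lemma Fq_independentD:
  assumes "Fq_independent q S" "finite T" "T \<subseteq> S"
    and "\<forall>v\<in>T. c v \<in> Fq q" "(\<Sum>v\<in>T. c v *s v) = 0" "v \<in> T"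
  shows "c v = 0"
  using assms(1)[unfolded Fq_independent_def, rule_format, of T c v] assms(2-) by blast

context finite_field_ext
begin

text \<open>Padding with zeros lets every combination use all of \<open>B\<close>, and extensional
  coefficient functions make each choice of coefficients a single object, so that combinations can
  be counted.\<close>

lemma Fq_span_finite:
  fixes B :: "('a ^ 'm) set"
  shows "Fq_span q B = (\<lambda>c. \<Sum>v\<in>B. c v *s v) ` (B \<rightarrow>\<^sub>E Fq q)"
proof (intro subset_antisym subsetI)
  fix x assume "x \<in> Fq_span q B"
  then obtain T c where *: "x = (\<Sum>v\<in>T. c v *s v)" "T \<subseteq> B" "\<forall>v\<in>T. c v \<in> Fq q"
    by (auto simp: Fq_span_def)
  define c' where "c' v = (if v \<in> T then c v else if v \<in> B then 0 else undefined)" for v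
  have "x = (\<Sum>v\<in>B. c' v *s v)"
    unfolding *(1) by (rule sum.mono_neutral_cong_left) (use *(2) in \<open>auto simp: c'_def\<close>)
  moreover have "c' \<in> B \<rightarrow>\<^sub>E Fq q" using * Fq_0 by (auto simp: c'_def)
  ultimately show "x \<in> (\<lambda>c. \<Sum>v\<in>B. c v *s v) ` (B \<rightarrow>\<^sub>E Fq q)" by blast
qed (auto simp: Fq_span_def PiE_iff)

lemma Fq_spanI:
  assumes "finite T" "T \<subseteq> S" "\<forall>v\<in>T. c v \<in> Fq q" "x = (\<Sum>v\<in>T. c v *s v)"
  shows "x \<in> Fq_span q S"
  unfolding Fq_span_def using assms by blast

lemma card_Fq_span:
  fixes B :: "('a ^ 'm) set"
  assumes "Fq_independent q B"
  shows "card (Fq_span q B) = q ^ card B"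
proof -
  have "inj_on (\<lambda>c. \<Sum>v\<in>B. c v *s v) (B \<rightarrow>\<^sub>E Fq q)"
  proof (rule inj_onI)
    fix c d assume cd: "c \<in> B \<rightarrow>\<^sub>E Fq q" "d \<in> B \<rightarrow>\<^sub>E Fq q" "(\<Sum>v\<in>B. c v *s v) = (\<Sum>v\<in>B. d v *s v)"
    have "(\<Sum>v\<in>B. (c v - d v) *s v) = 0"
      using cd(3) by (simp add: vec.scale_left_diff_distrib sum_subtractf)
    moreover have "\<forall>v\<in>B. c v - d v \<in> Fq q"
      using cd(1,2) by (blast intro: Fq_diff dest: PiE_mem)
    ultimately have "\<forall>v\<in>B. c v - d v = 0"
      using Fq_independentD[OF assms finite[of B] subset_refl, of "\<lambda>v. c v - d v"] by blast
    then show "c = d" using cd(1,2) by (intro PiE_ext[of c B "\<lambda>_. Fq q" d]) auto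
  qed
  then show ?thesis by (simp add: Fq_span_finite card_image card_PiE card_Fq)
qed

lemma Fq_subspace_sum:
  assumes "Fq_subspace q U" "\<And>i. i \<in> I \<Longrightarrow> f i \<in> U"
  shows "sum f I \<in> U"
  using assms(2) by (induction I rule: infinite_finite_induct) (use assms(1) in \<open>auto simp: Fq_subspace_def\<close>)

text \<open>A maximal independent subset exists by finiteness, and it spans: a vector of
  \<open>U\<close> outside its span could be added without losing independence. This makes the
  choice in \<open>Fq_dim\<close> meaningful.\<close>

lemma Fq_basis_exists:
  fixes U :: "('a ^ 'm) set"
  assumes U: "Fq_subspace q U"
  shows "\<exists>B. B \<subseteq> U \<and> Fq_independent q B \<and> Fq_span q B = U"
proof -
  define \<B> where "\<B> = {B. B \<subseteq> U \<and> Fq_independent q B}"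
  have "finite \<B>" by simp
  moreover have "{} \<in> \<B>" by (simp add: \<B>_def Fq_independent_def)
  ultimately obtain B where "B \<in> \<B>" and "\<forall>B'\<in>\<B>. B \<subseteq> B' \<longrightarrow> B = B'"
    using finite_has_maximal[of \<B>] by (metis empty_iff)
  then have B: "B \<subseteq> U" "Fq_independent q B"
    and max: "\<And>B'. B' \<subseteq> U \<Longrightarrow> Fq_independent q B' \<Longrightarrow> B \<subseteq> B' \<Longrightarrow> B = B'"
    by (simp_all add: \<B>_def)
  have "Fq_span q B \<subseteq> U"
    unfolding Fq_span_def using U B(1)
    by (auto intro!: Fq_subspace_sum[OF U] simp: Fq_subspace_def)
  moreover have "u \<in> Fq_span q B" if u: "u \<in> U" for u
  proof (rule ccontr)
    assume nin: "u \<notin> Fq_span q B"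
    have "Fq_independent q (insert u B)"
      unfolding Fq_independent_def
    proof (intro allI impI)
      fix T c assume "finite T \<and> T \<subseteq> insert u B \<and> (\<forall>v\<in>T. c v \<in> Fq q) \<and> (\<Sum>v\<in>T. c v *s v) = 0"
      then have T: "finite T" "T \<subseteq> insert u B" "\<forall>v\<in>T. c v \<in> Fq q" "(\<Sum>v\<in>T. c v *s v) = 0"
        by blast+
      have cu: "c u = 0" if "u \<in> T"
      proof (rule ccontr)
        assume c: "c u \<noteq> 0"
        have "c u *s u + (\<Sum>v\<in>T - {u}. c v *s v) = 0"
          using T(4) sum.remove[OF T(1) that, of "\<lambda>v. c v *s v"] by simp
        then have "c u *s u = - (\<Sum>v\<in>T - {u}. c v *s v)" by (simp add: eq_neg_iff_add_eq_0)
        then have "inverse (c u) *s (c u *s u) = (\<Sum>v\<in>T - {u}. (- (inverse (c u) * c v)) *s v)"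
          by (simp add: vec.scale_sum_right sum_negf)
        then have "u = (\<Sum>v\<in>T - {u}. (- (inverse (c u) * c v)) *s v)" using c by simp
        moreover have "\<forall>v\<in>T - {u}. - (inverse (c u) * c v) \<in> Fq q"
          using T(3) that by (blast intro: Fq_minus Fq_mult Fq_inverse)
        moreover have "finite (T - {u})" "T - {u} \<subseteq> B" using T(1,2) by auto
        ultimately have "u \<in> Fq_span q B"
          using Fq_spanI[of "T - {u}" B "\<lambda>v. - (inverse (c u) * c v)" u] by blast
        then show False using nin by contradiction
      qed
      have "(\<Sum>v\<in>T - {u}. c v *s v) = (\<Sum>v\<in>T. c v *s v)"
        by (rule sum.mono_neutral_left) (use T(1) cu in auto)
      then have "(\<Sum>v\<in>T - {u}. c v *s v) = 0" using T(4) by simp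
      moreover have "finite (T - {u})" "T - {u} \<subseteq> B" "\<forall>v\<in>T - {u}. c v \<in> Fq q"
        using T(1-3) by auto
      ultimately have "\<forall>v\<in>T - {u}. c v = 0"
        using Fq_independentD[OF B(2), of "T - {u}" c] by blast
      then show "\<forall>v\<in>T. c v = 0" using cu by auto
    qed
    then have "B = insert u B" using max[of "insert u B"] B(1) u by auto
    then have "u \<in> B" by blast
    then have "u \<in> Fq_span q B"
      using Fq_1 by (intro Fq_spanI[of "{u}" _ "\<lambda>_. 1"]) auto
    then show False using nin by simp
  qed
  ultimately show ?thesis using B by blast
qed

text \<open>Whatever basis \<open>Fq_dim\<close> chooses, the number of vectors is the same. From
  here on weights and ranks are obtained by counting instead of by exhibiting bases.\<close>

lemma card_Fq_subspace:
  fixes U :: "('a ^ 'm) set"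
  assumes "Fq_subspace q U"
  shows "card U = q ^ Fq_dim q U"
proof -
  define B where "B = (SOME B. B \<subseteq> U \<and> Fq_independent q B \<and> Fq_span q B = U)"
  have "B \<subseteq> U \<and> Fq_independent q B \<and> Fq_span q B = U"
    unfolding B_def by (rule someI_ex) (rule Fq_basis_exists[OF assms])
  moreover have "Fq_dim q U = card B" unfolding Fq_dim_def B_def ..
  ultimately show ?thesis using card_Fq_span by metis
qed

lemma Fq_dim_eq_iff:
  fixes U :: "('a ^ 'm) set"
  assumes "Fq_subspace q U"
  shows "Fq_dim q U = m \<longleftrightarrow> card U = q ^ m"
  using q_ge by (auto simp: card_Fq_subspace[OF assms])

lemma Fq_subspace_Int:
  "vec.subspace W \<Longrightarrow> Fq_subspace q U \<Longrightarrow> Fq_subspace q (W \<inter> (U :: ('a ^ 'm) set))"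
  by (auto simp: Fq_subspace_def vec.subspace_def)

text \<open>The weight of the point through \<open>u\<close> thus depends only on the scalars that
  keep \<open>u\<close> inside \<open>U\<close>, which turns it into the number of solutions of an
  equation in \<open>c\<close>.\<close>

lemma card_span_singleton_Int:
  assumes "u \<noteq> (0 :: 'a ^ 'm)"
  shows "card (vec.span {u} \<inter> U) = card {c. c *s u \<in> U}"
proof -
  have "vec.span {u} \<inter> U = (\<lambda>c. c *s u) ` {c. c *s u \<in> U}"
    by (auto simp: span_singleton_eq)
  moreover have "inj_on (\<lambda>c. c *s u) {c. c *s u \<in> U}"
    using assms by (auto intro!: inj_onI)
  ultimately show ?thesis by (simp add: card_image)
qed

lemma weight_eq_iff:
  assumes "Fq_subspace q U" "u \<noteq> 0"
  shows "weight q U (vec.span {u}) = m \<longleftrightarrow> card {c. c *s u \<in> (U :: ('a ^ 4) set)} = q ^ m"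
  using assms by (simp add: weight_def Fq_dim_eq_iff Fq_subspace_Int card_span_singleton_Int)

lemma long_line_iff:
  assumes "Fq_subspace q U"
  shows "long_line q n U l \<longleftrightarrow> is_line l \<and> card (l \<inter> (U :: ('a ^ 4) set)) = q ^ n"
proof (cases "is_line l")
  case True
  then have "Fq_subspace q (l \<inter> U)" using assms by (simp add: Fq_subspace_Int is_line_def)
  then show ?thesis using True by (simp add: long_line_def weight_def Fq_dim_eq_iff)
qed (simp add: long_line_def)

text \<open>Distinct points share only the zero vector, so nonzero vectors of \<open>U\<close> can
  be counted point by point. Applied to all points and to those of weight two, this gives the two
  equations that determine the size of the linear set.\<close>

lemma sum_card_points:
  fixes U :: "('a ^ 4) set"
  assumes U: "0 \<in> U" and S: "S \<subseteq> linear_set U"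
  shows "(\<Sum>P\<in>S. card (P \<inter> U) - 1) = card {u \<in> U - {0}. vec.span {u} \<in> S}"
proof -
  have span_eq: "vec.span {x} = vec.span {u}" if x: "x \<in> vec.span {u}" "x \<noteq> 0" for x u :: "'a ^ 4"
  proof -
    obtain c where c: "x = c *s u" using x(1) unfolding span_singleton_eq by blast
    then have "c \<noteq> 0" using x(2) by auto
    then have "u = inverse c *s x" using c by simp
    then have "u \<in> vec.span {x}" by (simp only: vec.span_scale vec.span_base singletonI)
    then show ?thesis using x(1) by (simp add: vec.span_eq)
  qed
  have "{u \<in> U - {0}. vec.span {u} \<in> S} = (\<Union>P\<in>S. P \<inter> U - {0})"
    using S span_eq by (fastforce simp: linear_set_def vec.span_base)
  moreover have "card (\<Union>P\<in>S. P \<inter> U - {0}) = (\<Sum>P\<in>S. card (P \<inter> U - {0}))"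
  proof (rule card_UN_disjoint; clarsimp)
    fix P Q assume PQ: "P \<in> S" "Q \<in> S" "P \<noteq> Q"
    obtain u v where "P = vec.span {u}" "Q = vec.span {v}"
      using S PQ(1,2) unfolding linear_set_def by blast
    then show "(P \<inter> U - {0}) \<inter> (Q \<inter> U - {0}) = {}" using span_eq PQ(3) by blast
  qed
  moreover have "card (P \<inter> U - {0}) = card (P \<inter> U) - 1" if "P \<in> S" for P
  proof -
    have "0 \<in> P \<inter> U" using that S U vec.span_zero by (auto simp: linear_set_def)
    then show ?thesis by (simp add: card_Diff_singleton)
  qed
  ultimately show ?thesis by simp
qed

end

subsection \<open>Pseudoreguli\<close>

context finite_field_ext
begin

text \<open>The vectors of \<open>U\<close> whose parameters \<open>(c, d)\<close> are proportional
  to \<open>(\<alpha>, \<gamma>)\<close> lie on the line joining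
  \<open>\<alpha> *s w1 + \<gamma> *s w2\<close> to
  \<open>\<tau> \<alpha> *s v1 + \<tau> \<gamma> *s v2\<close>. One such line for each point of a
  projective line forms the pseudoregulus; its transversals are the spans of \<open>w1\<close>,
  \<open>w2\<close> and of \<open>v1\<close>, \<open>v2\<close>.\<close>

lemma pseudoregulus_lines_exist:
  fixes w1 w2 v1 v2 :: "'a ^ 4"
  assumes \<tau>: "automorphism_fixing q (\<tau> :: 'a \<Rightarrow> 'a)"
    and indep: "\<And>c1 c2 d1 d2. c1 *s w1 + c2 *s w2 + d1 *s v1 + d2 *s v2 = 0
      \<Longrightarrow> c1 = 0 \<and> c2 = 0 \<and> d1 = 0 \<and> d2 = 0"
    and U_eq: "U = {c *s w1 + d *s w2 + \<tau> c *s v1 + \<tau> d *s v2 | c d. True}"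
    and U: "Fq_subspace q U"
  shows "\<exists>S. card S = q ^ n + 1 \<and>
          (\<forall>s\<in>S. long_line q n U s) \<and>
          (\<forall>s\<in>S. \<forall>s'\<in>S. s \<noteq> s' \<longrightarrow> \<not> lines_meet s s') \<and>
          card {t. is_line t \<and> points_on (linear_set U) t = {} \<and> (\<forall>s\<in>S. lines_meet t s)} = 2"
proof -
  define E where "E c1 c2 d1 d2 = c1 *s w1 + c2 *s w2 + d1 *s v1 + d2 *s v2" for c1 c2 d1 d2
  have E_add: "E a b c d + E a' b' c' d' = E (a + a') (b + b') (c + c') (d + d')" for a b c d a' b' c' d'
    by (simp add: E_def vec.scale_left_distrib algebra_simps)
  have E_scale: "x *s E a b c d = E (x * a) (x * b) (x * c) (x * d)" for x a b c d
    by (simp add: E_def vec.scale_right_distrib)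
  have E_zero: "E 0 0 0 0 = 0" by (simp add: E_def)
  have E_eq_0: "E a b c d = 0 \<longleftrightarrow> a = 0 \<and> b = 0 \<and> c = 0 \<and> d = 0" for a b c d
    using indep[of a b c d] by (auto simp: E_def)
  have E_inj: "E a b c d = E a' b' c' d' \<longleftrightarrow> a = a' \<and> b = b' \<and> c = c' \<and> d = d'" for a b c d a' b' c' d'
  proof -
    have "E a b c d = E a' b' c' d' \<longleftrightarrow> E a b c d + (-1) *s E a' b' c' d' = 0" by simp
    also have "\<dots> \<longleftrightarrow> a = a' \<and> b = b' \<and> c = c' \<and> d = d'"
      unfolding E_scale E_add E_eq_0 by simp
    finally show ?thesis .
  qed
  have U_E: "U = {E c d (\<tau> c) (\<tau> d) | c d. True}" by (simp add: U_eq E_def)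
  have \<tau>_mult: "\<tau> (x * y) = \<tau> x * \<tau> y" for x y
    using \<tau> by (simp add: automorphism_fixing_def)
  note \<tau>_0 = automorphism_fixing_eq_0_iff[OF \<tau>]
  note \<tau>_1 = automorphism_fixing_0_1[OF \<tau>]
  define ln where "ln = (\<lambda>(\<alpha>, \<gamma>). {E (\<kappa> * \<alpha>) (\<kappa> * \<gamma>) (\<mu> * \<tau> \<alpha>) (\<mu> * \<tau> \<gamma>) | \<kappa> \<mu>. True})"
  \<comment> \<open>One representative for each of the \<open>q ^ n + 1\<close> points of the
    projective line over the field.\<close>
  define D where "D = insert (0 :: 'a, 1 :: 'a) (range (Pair 1))"
  define S where "S = ln ` D"
  have ln_span: "ln (\<alpha>, \<gamma>) = vec.span {E \<alpha> \<gamma> 0 0, E 0 0 (\<tau> \<alpha>) (\<tau> \<gamma>)}" for \<alpha> \<gamma>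
    by (simp add: ln_def span_pair_eq E_scale E_add)
  have ln_line: "is_line (ln p)" if "p \<in> D" for p
    using that unfolding D_def
    by (auto simp: ln_span E_scale E_add E_eq_0 \<tau>_1 intro!: is_line_spanI)
  have ln_disjoint: "ln p \<inter> ln p' = {0}" if "p \<in> D" "p' \<in> D" "p \<noteq> p'" for p p'
  proof -
    obtain \<alpha> \<gamma> \<alpha>' \<gamma>' where p: "p = (\<alpha>, \<gamma>)" "p' = (\<alpha>', \<gamma>')" by (metis surj_pair)
    \<comment> \<open>Different representatives have nonzero determinant, and so do their images
      under \<tau>. By Cramer's rule (\<open>par\<close>) proportional multiples of them must
      vanish.\<close>
    have ne: "\<alpha> * \<gamma>' \<noteq> \<alpha>' * \<gamma>" using that unfolding D_def p by auto
    then have \<tau>ne: "\<tau> \<alpha> * \<tau> \<gamma>' \<noteq> \<tau> \<alpha>' * \<tau> \<gamma>"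
      using \<tau> unfolding automorphism_fixing_def by (metis bij_is_inj injD)
    have par: "\<kappa> = 0" if "\<kappa> * a = \<kappa>' * a'" "\<kappa> * b = \<kappa>' * b'" "a * b' \<noteq> a' * b" for \<kappa> \<kappa>' a a' b b' :: 'a
    proof -
      have "\<kappa> * (a * b' - a' * b) = (\<kappa> * a) * b' - a' * (\<kappa> * b)" by (simp add: algebra_simps)
      also have "\<dots> = 0" unfolding that(1,2) by (simp add: algebra_simps)
      finally show ?thesis using that(3) by simp
    qed
    have "x = 0" if xl: "x \<in> ln p" "x \<in> ln p'" for x
    proof -
      obtain \<kappa> \<mu> \<kappa>' \<mu>' where x: "x = E (\<kappa> * \<alpha>) (\<kappa> * \<gamma>) (\<mu> * \<tau> \<alpha>) (\<mu> * \<tau> \<gamma>)"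
        "x = E (\<kappa>' * \<alpha>') (\<kappa>' * \<gamma>') (\<mu>' * \<tau> \<alpha>') (\<mu>' * \<tau> \<gamma>')"
        using xl unfolding p ln_def prod.case by blast
      then have "\<kappa> = 0" "\<mu> = 0"
        using par[of \<kappa> \<alpha> \<kappa>' \<alpha>' \<gamma> \<gamma>'] par[of \<mu> "\<tau> \<alpha>" \<mu>' "\<tau> \<alpha>'" "\<tau> \<gamma>" "\<tau> \<gamma>'"] ne \<tau>ne
        by (simp_all add: E_inj)
      then show ?thesis using x(1) E_zero by simp
    qed
    moreover have "0 \<in> ln p" "0 \<in> ln p'" using vec.span_zero by (auto simp: p ln_span)
    ultimately show ?thesis by blast
  qed
  have "inj_on ln D"
  proof (rule inj_onI, rule ccontr)
    fix p p' assume *: "p \<in> D" "p' \<in> D" "ln p = ln p'" "p \<noteq> p'"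
    then have "ln p = {0}" using ln_disjoint by blast
    then show False using ln_line[OF *(1)] by (simp add: is_line_def)
  qed
  moreover have "card D = q ^ n + 1"
  proof -
    have "card (range (Pair (1::'a)) :: ('a \<times> 'a) set) = q ^ n"
      by (simp add: card_image inj_on_def card_UNIV_eq)
    then show ?thesis unfolding D_def by (subst card_insert_disjoint) auto
  qed
  ultimately have cardS: "card S = q ^ n + 1" unfolding S_def by (simp add: card_image)
  have long: "long_line q n U (ln p)" if "p \<in> D" for p
  proof -
    obtain \<alpha> \<gamma> where p: "p = (\<alpha>, \<gamma>)" by (metis surj_pair)
    have ne: "\<alpha> \<noteq> 0 \<or> \<gamma> \<noteq> 0" using that unfolding D_def p by auto
    let ?f = "\<lambda>\<kappa>. E (\<kappa> * \<alpha>) (\<kappa> * \<gamma>) (\<tau> \<kappa> * \<tau> \<alpha>) (\<tau> \<kappa> * \<tau> \<gamma>)"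
    have "ln p \<inter> U = range ?f"
    proof (intro subset_antisym subsetI)
      fix x assume "x \<in> ln p \<inter> U"
      then obtain \<kappa> \<mu> c d where x: "x = E (\<kappa> * \<alpha>) (\<kappa> * \<gamma>) (\<mu> * \<tau> \<alpha>) (\<mu> * \<tau> \<gamma>)"
        and x': "x = E c d (\<tau> c) (\<tau> d)"
        unfolding p ln_def U_E prod.case by blast
      then have "c = \<kappa> * \<alpha>" "d = \<kappa> * \<gamma>" by (auto simp: E_inj)
      then show "x \<in> range ?f" using x' by (auto simp: \<tau>_mult)
    next
      fix x assume "x \<in> range ?f"
      then obtain \<kappa> where x: "x = ?f \<kappa>" by blast
      then have "x = E (\<kappa> * \<alpha>) (\<kappa> * \<gamma>) (\<tau> (\<kappa> * \<alpha>)) (\<tau> (\<kappa> * \<gamma>))" by (simp add: \<tau>_mult)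
      then have "x \<in> U" unfolding U_eq E_def by blast
      moreover have "x \<in> ln p" using x by (auto simp: p ln_def)
      ultimately show "x \<in> ln p \<inter> U" by blast
    qed
    moreover have "inj ?f" using ne by (auto simp: inj_def E_inj)
    ultimately have "card (ln p \<inter> U) = q ^ n" by (simp add: card_image card_UNIV_eq)
    then show ?thesis using ln_line[OF that] by (simp add: long_line_iff[OF U])
  qed
  define T1 where "T1 = vec.span {w1, w2}"
  define T2 where "T2 = vec.span {v1, v2}"
  have T1_eq: "T1 = {E a b 0 0 | a b. True}" and T2_eq: "T2 = {E 0 0 a b | a b. True}"
    by (simp_all add: T1_def T2_def span_pair_eq E_def)
  have T_line: "is_line T1" "is_line T2"
    unfolding T1_def T2_def
    using indep[of _ _ 0 0] indep[of 0 0] by (auto intro!: is_line_spanI)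
  have T_neq: "T1 \<noteq> T2"
  proof
    assume "T1 = T2"
    then have "E 1 0 0 0 \<in> T2" unfolding T1_eq[symmetric] using T1_eq by blast
    then show False by (auto simp: T2_eq E_inj)
  qed
  have T_disjoint: "points_on (linear_set U) T = {}" if "T = T1 \<or> T = T2" for T
  proof -
    have "u = 0" if u: "u \<in> U" "u \<in> T" for u
    proof -
      obtain c d where cd: "u = E c d (\<tau> c) (\<tau> d)"
        using u(1) by (auto simp: U_eq E_def)
      have "c = 0 \<and> d = 0" using u(2) \<open>T = T1 \<or> T = T2\<close> cd
        by (auto simp: T1_eq T2_eq E_inj \<tau>_0)
      then show ?thesis using cd by (simp add: \<tau>_1 E_zero)
    qed
    then show ?thesis
      unfolding points_on_def linear_set_def using vec.span_base by blast
  qed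
  have T_meet: "lines_meet T (ln p)" if "T = T1 \<or> T = T2" "p \<in> D" for T p
  proof -
    obtain \<alpha> \<gamma> where p: "p = (\<alpha>, \<gamma>)" by (metis surj_pair)
    have ne: "\<alpha> \<noteq> 0 \<or> \<gamma> \<noteq> 0" using that(2) unfolding D_def p by auto
    have "E \<alpha> \<gamma> 0 0 \<in> T1 \<inter> ln p" "E 0 0 (\<tau> \<alpha>) (\<tau> \<gamma>) \<in> T2 \<inter> ln p"
      by (auto simp: T1_eq T2_eq p ln_span vec.span_base)
    moreover have "E \<alpha> \<gamma> 0 0 \<noteq> 0" "E 0 0 (\<tau> \<alpha>) (\<tau> \<gamma>) \<noteq> 0" using ne by (auto simp: E_eq_0 \<tau>_0)
    ultimately show ?thesis using that(1) unfolding lines_meet_def by blast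
  qed
  have only: "t = T1 \<or> t = T2" if t: "is_line t" "\<forall>s\<in>S. lines_meet t s" for t
  proof -
    have sub: "vec.subspace t" and dim: "vec.dim t = 2" using t(1) by (auto simp: is_line_def)
    have meet: "\<exists>\<kappa> \<mu>. (\<kappa> \<noteq> 0 \<or> \<mu> \<noteq> 0) \<and> E (\<kappa> * \<alpha>) (\<kappa> * \<gamma>) (\<mu> * \<tau> \<alpha>) (\<mu> * \<tau> \<gamma>) \<in> t"
      if "(\<alpha>, \<gamma>) \<in> D" for \<alpha> \<gamma>
    proof -
      have "lines_meet t (ln (\<alpha>, \<gamma>))" using t(2) that by (simp add: S_def)
      moreover have "0 \<in> t \<inter> ln (\<alpha>, \<gamma>)"
        using sub vec.span_zero by (auto simp: ln_span vec.subspace_0)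
      ultimately obtain x where "x \<in> t" "x \<in> ln (\<alpha>, \<gamma>)" "x \<noteq> 0"
        unfolding lines_meet_def by blast
      then obtain \<kappa> \<mu> where "E (\<kappa> * \<alpha>) (\<kappa> * \<gamma>) (\<mu> * \<tau> \<alpha>) (\<mu> * \<tau> \<gamma>) \<in> t"
        "E (\<kappa> * \<alpha>) (\<kappa> * \<gamma>) (\<mu> * \<tau> \<alpha>) (\<mu> * \<tau> \<gamma>) \<noteq> 0"
        unfolding ln_def by auto
      moreover from this(2) have "\<kappa> \<noteq> 0 \<or> \<mu> \<noteq> 0" by (auto simp: E_eq_0)
      ultimately show ?thesis by blast
    qed
    obtain \<kappa>0 \<mu>0 where 0: "\<kappa>0 \<noteq> 0 \<or> \<mu>0 \<noteq> 0" "E \<kappa>0 0 \<mu>0 0 \<in> t"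
      using meet[of 1 0] by (auto simp: D_def \<tau>_1)
    obtain \<kappa>1 \<mu>1 where 1: "\<kappa>1 \<noteq> 0 \<or> \<mu>1 \<noteq> 0" "E 0 \<kappa>1 0 \<mu>1 \<in> t"
      using meet[of 0 1] by (auto simp: D_def \<tau>_1)
    have lin: "is_line (vec.span {E \<kappa>0 0 \<mu>0 0, E 0 \<kappa>1 0 \<mu>1})"
      using 0(1) 1(1) by (intro is_line_spanI) (auto simp: E_scale E_add E_eq_0)
    have "vec.span {E \<kappa>0 0 \<mu>0 0, E 0 \<kappa>1 0 \<mu>1} \<subseteq> t"
      using 0(2) 1(2) sub by (intro vec.span_minimal) auto
    then have t_eq: "vec.span {E \<kappa>0 0 \<mu>0 0, E 0 \<kappa>1 0 \<mu>1} = t"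
      using vec.subspace_dim_equal[OF _ sub] lin dim by (simp add: is_line_def)
    \<comment> \<open>This is the condition that \<open>t\<close>, spanned by its points on the
      lines of \<open>(1, 0)\<close> and \<open>(0, 1)\<close>, also meets the line of
      \<open>(1, c)\<close>. If \<open>\<kappa>0\<close> and \<open>\<mu>0\<close> were both
      nonzero, comparison with \<open>c = 1\<close> would give \<open>\<tau> c = c\<close> for all
      \<open>c\<close>. So one of them vanishes and \<open>t\<close> is \<open>T1\<close> or
      \<open>T2\<close>.\<close>
    have ratio: "\<exists>e. e \<noteq> 0 \<and> \<kappa>0 * c = e * \<kappa>1 \<and> \<mu>0 * \<tau> c = e * \<mu>1" if c: "c \<noteq> 0" for c
    proof -
      obtain \<kappa> \<mu> where \<kappa>\<mu>: "\<kappa> \<noteq> 0 \<or> \<mu> \<noteq> 0" "E \<kappa> (\<kappa> * c) \<mu> (\<mu> * \<tau> c) \<in> t"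
        using meet[of 1 c] by (auto simp: D_def \<tau>_1)
      then obtain a d where ad: "\<kappa> = a * \<kappa>0" "\<kappa> * c = d * \<kappa>1" "\<mu> = a * \<mu>0" "\<mu> * \<tau> c = d * \<mu>1"
        unfolding t_eq[symmetric] by (auto simp: span_pair_eq E_scale E_add E_inj)
      have "a \<noteq> 0" using ad(1,3) \<kappa>\<mu>(1) by auto
      moreover have "d \<noteq> 0" using ad(2,4) \<kappa>\<mu>(1) c by (auto simp: \<tau>_0)
      ultimately show ?thesis using ad
        by (intro exI[of _ "d / a"]) (simp add: field_simps)
    qed
    show ?thesis
    proof (cases "\<kappa>0 = 0")
      case True
      then have "\<kappa>1 = 0" using ratio[of 1] by auto
      have "T2 \<subseteq> t" if "T2 \<subseteq> t \<or> t \<subseteq> T2"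
        using that vec.subspace_dim_equal[of t T2] T_line(2) sub dim by (auto simp: is_line_def)
      moreover have "t \<subseteq> T2"
        unfolding t_eq[symmetric] T2_eq using True \<open>\<kappa>1 = 0\<close>
        by (auto simp: span_pair_eq E_scale E_add)
      ultimately show ?thesis by blast
    next
      case \<kappa>0: False
      show ?thesis
      proof (cases "\<mu>0 = 0")
        case True
        then have "\<mu>1 = 0" using ratio[of 1] by auto
        have "T1 \<subseteq> t" if "T1 \<subseteq> t \<or> t \<subseteq> T1"
          using that vec.subspace_dim_equal[of t T1] T_line(1) sub dim by (auto simp: is_line_def)
        moreover have "t \<subseteq> T1"
          unfolding t_eq[symmetric] T1_eq using True \<open>\<mu>1 = 0\<close>
          by (auto simp: span_pair_eq E_scale E_add)
        ultimately show ?thesis by blast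
      next
        case \<mu>0: False
        obtain e1 where e1: "e1 \<noteq> 0" "\<kappa>0 = e1 * \<kappa>1" "\<mu>0 = e1 * \<mu>1"
          using ratio[of 1] by (auto simp: \<tau>_1)
        have "\<tau> c = c" for c
        proof (cases "c = 0")
          case False
          then obtain e where e: "e \<noteq> 0" "\<kappa>0 * c = e * \<kappa>1" "\<mu>0 * \<tau> c = e * \<mu>1"
            using ratio by blast
          then show ?thesis using e1 \<kappa>0 \<mu>0 by (auto simp: field_simps)
        qed (simp add: \<tau>_1)
        then have "Fq q = (UNIV :: 'a set)" using \<tau> unfolding automorphism_fixing_def by auto
        then have "q = q ^ n" using card_Fq card_UNIV_eq by simp
        then have "q ^ 1 = q ^ n" by simp
        then have "n = 1" using q_ge by (metis power_inject_exp One_nat_def Suc_le_lessD numeral_3_eq_3 Suc_leD)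
        then show ?thesis using n_ge by simp
      qed
    qed
  qed
  have "{t. is_line t \<and> points_on (linear_set U) t = {} \<and> (\<forall>s\<in>S. lines_meet t s)} = {T1, T2}"
    using only T_line T_disjoint T_meet by (auto simp: S_def)
  then have "card {t. is_line t \<and> points_on (linear_set U) t = {} \<and> (\<forall>s\<in>S. lines_meet t s)} = 2"
    using T_neq by simp
  moreover have "\<forall>s\<in>S. \<forall>s'\<in>S. s \<noteq> s' \<longrightarrow> \<not> lines_meet s s'"
    using ln_disjoint unfolding S_def lines_meet_def by blast
  moreover have "\<forall>s\<in>S. long_line q n U s" using long by (auto simp: S_def)
  ultimately show ?thesis using cardS by blast
qed

end

subsection \<open>Trace and quadratic forms\<close>

definition Tr :: "nat \<Rightarrow> nat \<Rightarrow> 'a::{field,finite} \<Rightarrow> 'a" where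
  "Tr q n x = (\<Sum>i<n. x ^ (q ^ i))"

context finite_field_ext
begin

lemma Tr_add: "Tr q n (x + y :: 'a) = Tr q n x + Tr q n y"
  by (simp add: Tr_def frob_add sum.distrib)

lemma Tr_diff: "Tr q n (x - y :: 'a) = Tr q n x - Tr q n y"
  by (simp add: Tr_def frob_diff sum_subtractf)

lemma Tr_scale: "c \<in> Fq q \<Longrightarrow> Tr q n (c * x :: 'a) = c * Tr q n x"
  by (simp add: Tr_def power_mult_distrib Fq_frob sum_distrib_left)

lemma Tr_in_Fq: "Tr q n (x :: 'a) \<in> Fq q"
proof -
  obtain m where m: "n = Suc m" using n_ge by (cases n) auto
  have "Tr q n x ^ q = Tr q n x ^ (q ^ 1)" by simp
  also have "\<dots> = (\<Sum>i<n. x ^ (q ^ Suc i))"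
    by (simp only: Tr_def frob_sum frob_frob) simp
  also have "\<dots> = (\<Sum>i<m. x ^ (q ^ Suc i)) + x ^ (q ^ n)"
    unfolding m by simp
  also have "\<dots> = x ^ (q ^ 0) + (\<Sum>i<m. x ^ (q ^ Suc i))" by simp
  also have "\<dots> = Tr q n x"
    unfolding Tr_def m by (rule sum.lessThan_Suc_shift[symmetric])
  finally show ?thesis by (simp add: Fq_def)
qed

lemma Tr_frob: "Tr q n (x ^ (q ^ j) :: 'a) = Tr q n x"
proof -
  have "Tr q n (x ^ (q ^ j)) = Tr q n x ^ (q ^ j)"
    by (simp add: Tr_def frob_sum frob_frob add.commute)
  then show ?thesis by (simp add: Fq_frob Tr_in_Fq)
qed

text \<open>The kernel consists of the roots of a nonzero polynomial of degree at most
  \<open>q ^ (n - 1)\<close>. The bound shows that the trace is not identically zero and provides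
  one half of the count behind the additive Hilbert 90.\<close>

lemma card_Tr_kernel_le: "card {x::'a. Tr q n x = 0} \<le> q ^ (n - 1)"
proof -
  let ?p = "\<Sum>i<n. monom (1::'a) (q ^ i)"
  have "coeff ?p (q ^ (n - 1)) = (\<Sum>i<n. if i = n - 1 then 1 else 0)"
    unfolding coeff_sum
    by (rule sum.cong) (use q_ge in auto)
  also have "\<dots> = 1" using n_ge by simp
  finally have "?p \<noteq> 0" by (metis coeff_0 zero_neq_one)
  then have "card {x. poly ?p x = 0} \<le> degree ?p" by (rule card_poly_roots_bound)
  also have "\<dots> \<le> q ^ (n - 1)"
  proof (rule degree_sum_le)
    fix i assume "i \<in> {..<n}"
    then have "q ^ i \<le> q ^ (n - 1)" using q_ge by (intro power_increasing) auto
    then show "degree (monom (1::'a) (q ^ i)) \<le> q ^ (n - 1)"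
      using degree_monom_le order.trans by blast
  qed simp
  finally show ?thesis by (simp add: poly_sum poly_monom Tr_def)
qed

text \<open>The multiples of a nonzero \<open>z\<close> exhaust the field, so otherwise the trace
  would vanish everywhere, against the bound on its kernel.\<close>

lemma Tr_nondegenerate:
  assumes "z \<noteq> (0::'a)"
  shows "\<exists>y. Tr q n (y * z) \<noteq> 0"
proof (rule ccontr)
  assume *: "\<not> ?thesis"
  have "Tr q n x = 0" for x :: 'a
    using * assms by (metis nonzero_divide_eq_eq)
  then have "{x::'a. Tr q n x = 0} = UNIV" by simp
  then have "q ^ n \<le> q ^ (n - 1)" using card_Tr_kernel_le by (simp add: card_UNIV_eq)
  then have "n \<le> n - 1" using q_ge power_le_imp_le_exp[of q n "n - 1"] by simp
  then show False using n_ge by simp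
qed

lemma card_frob_diff_fibre:
  fixes y :: 'a
  assumes "coprime j n"
  shows "card {x. x - x ^ (q ^ j) = y - y ^ (q ^ j)} = card (Fq q :: 'a set)"
proof -
  have fix_iff: "x ^ (q ^ j) = x \<longleftrightarrow> x \<in> Fq q" for x :: 'a
    using automorphism_fixing_frob[OF assms] unfolding automorphism_fixing_def by blast
  have "x - x ^ (q ^ j) = y - y ^ (q ^ j) \<longleftrightarrow> x - y \<in> Fq q" for x
    unfolding fix_iff[symmetric] frob_diff by (auto simp: algebra_simps)
  moreover have "x - y \<in> Fq q \<longleftrightarrow> x \<in> (\<lambda>c. c + y) ` Fq q" for x
    using imageI[of "x - y" "Fq q" "\<lambda>c. c + y"] by auto
  ultimately have "{x. x - x ^ (q ^ j) = y - y ^ (q ^ j)} = (\<lambda>c. c + y) ` Fq q"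
    by blast
  then show ?thesis by (simp add: card_image)
qed

text \<open>The additive Hilbert 90, again by counting.\<close>

lemma range_frob_diff:
  assumes "coprime j n"
  shows "range (\<lambda>x::'a. x - x ^ (q ^ j)) = {x. Tr q n x = 0}"
proof (rule card_seteq)
  show "range (\<lambda>x::'a. x - x ^ (q ^ j)) \<subseteq> {x. Tr q n x = 0}"
    by (auto simp: Tr_diff Tr_frob)
  have "card (UNIV :: 'a set) = card (range (\<lambda>x::'a. x - x ^ (q ^ j))) * q"
    by (rule card_eq_card_image_times) (simp_all add: card_frob_diff_fibre[OF assms] card_Fq)
  moreover have "card (UNIV :: 'a set) = q ^ (n - 1) * q"
    using n_ge by (simp add: card_UNIV_eq flip: power_Suc2)
  ultimately have "card (range (\<lambda>x::'a. x - x ^ (q ^ j))) = q ^ (n - 1)"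
    using q_ge by simp
  then show "card {x::'a. Tr q n x = 0} \<le> card (range (\<lambda>x::'a. x - x ^ (q ^ j)))"
    using card_Tr_kernel_le by simp
qed simp

lemma card_frob_diff_eq:
  assumes "coprime j n" "Tr q n \<mu> = 0"
  shows "card {x::'a. x - x ^ (q ^ j) = \<mu>} = q"
proof -
  have "\<mu> \<in> range (\<lambda>x::'a. x - x ^ (q ^ j))" using assms by (simp add: range_frob_diff)
  then obtain y where "\<mu> = y - y ^ (q ^ j)" by blast
  then show ?thesis using card_frob_diff_fibre[OF assms(1)] by (simp add: card_Fq)
qed

text \<open>Both maps are two-to-one on the nonzero elements of \<open>Fq q\<close>, and their
  images there are disjoint halves, since a common value would make \<xi> a square. The element 0 is
  hit once by each map. So every element is hit twice in total.\<close>

lemma sum_squares_nonsquares: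
  fixes g :: "'a \<Rightarrow> nat"
  assumes \<xi>: "\<xi> \<in> Fq q" "\<not> (\<exists>y\<in>Fq q. y\<^sup>2 = \<xi>)"
  shows "(\<Sum>t\<in>Fq q. g (t\<^sup>2)) + (\<Sum>t\<in>Fq q. g (\<xi> * t\<^sup>2)) = 2 * (\<Sum>u\<in>Fq q. g u)"
proof -
  let ?F = "Fq q - {0::'a}"
  have \<xi>0: "\<xi> \<noteq> 0" using \<xi>(2) Fq_0 by force
  have fib: "card {z \<in> ?F. z\<^sup>2 = x\<^sup>2} = 2" if "x \<in> ?F" for x
  proof -
    have "{z \<in> ?F. z\<^sup>2 = x\<^sup>2} = {x, - x}"
      using that by (auto simp: power2_eq_iff Fq_minus)
    moreover have "x \<noteq> - x" using that by (simp add: eq_minus_iff)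
    ultimately show ?thesis by simp
  qed
  have fib': "card {z \<in> ?F. \<xi> * z\<^sup>2 = \<xi> * x\<^sup>2} = 2" if "x \<in> ?F" for x
    using fib[OF that] \<xi>0 by simp
  define A B where "A = (\<lambda>t. t\<^sup>2) ` ?F" and "B = (\<lambda>t. \<xi> * t\<^sup>2) ` ?F"
  have cA: "card ?F = card A * 2" unfolding A_def
    by (rule card_eq_card_image_times) (use fib in auto)
  have cB: "card ?F = card B * 2" unfolding B_def
    by (rule card_eq_card_image_times) (use fib' in auto)
  have disj: "A \<inter> B = {}"
  proof (rule ccontr)
    assume "A \<inter> B \<noteq> {}"
    then obtain s t where st: "s \<in> ?F" "t \<in> ?F" "s\<^sup>2 = \<xi> * t\<^sup>2" by (auto simp: A_def B_def)
    then have "(s / t)\<^sup>2 = \<xi>" by (simp add: power_divide)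
    moreover have "s / t \<in> Fq q" using st by (simp add: Fq_divide)
    ultimately show False using \<xi>(2) by blast
  qed
  have AB: "A \<union> B = ?F"
  proof (rule card_seteq)
    show "A \<union> B \<subseteq> ?F" using \<xi>(1) \<xi>0 by (auto simp: A_def B_def power2_eq_square Fq_mult)
    show "card ?F \<le> card (A \<union> B)" using cA cB disj by (simp add: card_Un_disjoint)
  qed simp
  have "(\<Sum>t\<in>Fq q. g (t\<^sup>2)) = g 0 + (\<Sum>t\<in>?F. g (t\<^sup>2))"
    using Fq_0 by (simp add: sum.remove[of "Fq q" 0])
  moreover have "(\<Sum>t\<in>?F. g (t\<^sup>2)) = 2 * sum g A"
    unfolding A_def using sum_comp_fibres[of ?F "\<lambda>t. t\<^sup>2" 2 g] fib by simp
  moreover have "(\<Sum>t\<in>Fq q. g (\<xi> * t\<^sup>2)) = g 0 + (\<Sum>t\<in>?F. g (\<xi> * t\<^sup>2))"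
    using Fq_0 by (simp add: sum.remove[of "Fq q" 0])
  moreover have "(\<Sum>t\<in>?F. g (\<xi> * t\<^sup>2)) = 2 * sum g B"
    unfolding B_def using sum_comp_fibres[of ?F "\<lambda>t. \<xi> * t\<^sup>2" 2 g] fib' by simp
  moreover have "sum g ?F = sum g A + sum g B"
    unfolding AB[symmetric] by (rule sum.union_disjoint) (use disj in auto)
  moreover have "(\<Sum>u\<in>Fq q. g u) = g 0 + sum g ?F"
    using Fq_0 by (simp add: sum.remove[of "Fq q" 0])
  ultimately show ?thesis by simp
qed

text \<open>The number \<open>N c\<close> of representations of \<open>c\<close> by a quadratic form of rank \<open>k\<close> satisfies
  \<open>N (\<xi> * c) - m = (- 1) ^ k * (N c - m)\<close> for a non-square \<open>\<xi>\<close>, where \<open>m\<close> is the mean value of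
  \<open>N\<close>. This sign rule survives the splitting off of an anisotropic vector. For odd rank it
  determines \<open>N 0\<close>.\<close>

lemma quadratic_form_representations:
  fixes Q :: "'a \<Rightarrow> 'a" and P :: "'a \<Rightarrow> 'a \<Rightarrow> 'a"
  assumes \<xi>: "\<xi> \<in> Fq q" "\<not> (\<exists>y\<in>Fq q. y\<^sup>2 = \<xi>)"
    and Q_add: "\<And>x y. Q (x + y) = Q x + Q y + P x y"
    and Q_scale: "\<And>c x. c \<in> Fq q \<Longrightarrow> Q (c * x) = c\<^sup>2 * Q x"
    and Q_Fq: "\<And>x. Q x \<in> Fq q"
    and P_add: "\<And>x y z. P x (y + z) = P x y + P x z"
    and P_scale: "\<And>c x y. c \<in> Fq q \<Longrightarrow> P x (c * y) = c * P x y"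
    and V: "0 \<in> V" "\<And>x y. x \<in> V \<Longrightarrow> y \<in> V \<Longrightarrow> x + y \<in> V" "\<And>c x. c \<in> Fq q \<Longrightarrow> x \<in> V \<Longrightarrow> c * x \<in> V"
  shows "\<exists>k W. W \<subseteq> V \<and> 0 \<in> W \<and> card V = q ^ k * card W \<and> (\<forall>w\<in>W. \<forall>v\<in>V. P w v = 0) \<and>
    (\<forall>c\<in>Fq q. if even k then card {v \<in> V. Q v = \<xi> * c} = card {v \<in> V. Q v = c}
       else q * (card {v \<in> V. Q v = \<xi> * c} + card {v \<in> V. Q v = c}) = 2 * card V)"
  using V
proof (induction "card V" arbitrary: V rule: less_induct)
  case (less V)
  have \<xi>0: "\<xi> \<noteq> 0" using \<xi>(2) Fq_0 by force
  have P_eq: "P x y = Q (x + y) - Q x - Q y" for x y by (simp add: Q_add)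
  have P_sym: "P x y = P y x" for x y by (simp add: P_eq add.commute)
  show ?case
  proof (cases "\<forall>v\<in>V. Q v = 0")
    case True
    have "card {v \<in> V. Q v = \<xi> * c} = card {v \<in> V. Q v = c}" for c
      using True \<xi>0 by (intro arg_cong[of _ _ card]) auto
    moreover have "\<forall>w\<in>V. \<forall>v\<in>V. P w v = 0" using True less.prems(2) by (simp add: P_eq)
    ultimately show ?thesis using less.prems(1)
      by (intro exI[of _ 0] exI[of _ V]) simp
  next
    case False
    then obtain e where e: "e \<in> V" "Q e \<noteq> 0" by blast
    define a where "a = Q e"
    have a: "a \<noteq> 0" "a \<in> Fq q" using e Q_Fq by (auto simp: a_def)
    have two: "(2::'a) \<in> Fq q" using Fq_add[OF Fq_1 Fq_1] by simp
    have "Q (2 * e) = 4 * a" using Q_scale[OF two, of e] by (simp add: a_def)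
    then have Pee: "P e e = 2 * a" unfolding P_eq mult_2[symmetric] by (simp add: a_def)
    have P_Fq: "P x y \<in> Fq q" for x y unfolding P_eq by (intro Fq_diff Q_Fq)
    define V' where "V' = {v \<in> V. P e v = 0}"
    \<comment> \<open>\<open>V'\<close> is the orthogonal complement of \<open>e\<close> in
      \<open>V\<close>. Because \<open>P e e = 2 * a\<close> with \<open>a\<close> nonzero and odd
      characteristic, the component of \<open>v\<close> along \<open>e\<close> is
      \<open>P e v / (2 * a)\<close>.\<close>
    have split: "bij_betw (\<lambda>(t, v). t * e + v) (Fq q \<times> V') V"
    proof (rule bij_betw_byWitness[where f' = "\<lambda>v. (P e v / (2 * a), v - P e v / (2 * a) * e)"])
      have *: "P e (t * e + v) = t * (2 * a)" if "t \<in> Fq q" "v \<in> V'" for t v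
        using that by (simp add: P_add P_scale Pee V'_def)
      show "\<forall>p\<in>Fq q \<times> V'. (\<lambda>v. (P e v / (2 * a), v - P e v / (2 * a) * e)) ((\<lambda>(t, v). t * e + v) p) = p"
        using a two_neq_0 by (auto simp: *)
      show "\<forall>v\<in>V. (\<lambda>(t, v). t * e + v) (P e v / (2 * a), v - P e v / (2 * a) * e) = v" by simp
      show "(\<lambda>(t, v). t * e + v) ` (Fq q \<times> V') \<subseteq> V"
        using less.prems e by (auto simp: V'_def)
      show "(\<lambda>v. (P e v / (2 * a), v - P e v / (2 * a) * e)) ` V \<subseteq> Fq q \<times> V'"
      proof (clarsimp, intro conjI)
        fix v assume v: "v \<in> V"
        show t: "P e v / (2 * a) \<in> Fq q" by (intro Fq_divide Fq_mult P_Fq two a(2))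
        have mt: "- (P e v / (2 * a)) \<in> Fq q" by (intro Fq_minus t)
        have eq: "v - P e v * e / (2 * a) = v + - (P e v / (2 * a)) * e" by simp
        have "P e (v + - (P e v / (2 * a)) * e) = 0"
          unfolding P_add P_scale[OF mt] Pee using a two_neq_0 by simp
        moreover have "v + - (P e v / (2 * a)) * e \<in> V" using less.prems v e mt by blast
        ultimately show "v - P e v * e / (2 * a) \<in> V'" unfolding V'_def eq by blast
      qed
    qed
    have cardV: "card V = q * card V'"
      using bij_betw_same_card[OF split] by (simp add: card_cartesian_product card_Fq)
    have Q_split: "Q (t * e + v) = a * t\<^sup>2 + Q v" if "t \<in> Fq q" "v \<in> V'" for t v
    proof -
      have "P (t * e) v = t * P e v" using that(1) by (simp add: P_sym[of _ v] P_scale)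
      then show ?thesis using that by (simp add: Q_add Q_scale V'_def a_def)
    qed
    define N' where "N' c = card {v \<in> V'. Q v = c}" for c
    have N: "card {v \<in> V. Q v = c} = (\<Sum>t\<in>Fq q. N' (c - a * t\<^sup>2))" for c
    proof -
      have "bij_betw (\<lambda>(t, v). t * e + v) (SIGMA t:Fq q. {v \<in> V'. Q v = c - a * t\<^sup>2}) {v \<in> V. Q v = c}"
      proof (rule bij_betw_subset[OF split])
        have "v \<in> V \<and> Q v = c \<longleftrightarrow> (\<exists>t\<in>Fq q. \<exists>w\<in>V'. v = t * e + w \<and> Q w = c - a * t\<^sup>2)" for v
        proof -
          have "v \<in> V \<longleftrightarrow> (\<exists>t\<in>Fq q. \<exists>w\<in>V'. v = t * e + w)"
            unfolding bij_betw_imp_surj_on[OF split, symmetric] by auto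
          moreover have "Q (t * e + w) = c \<longleftrightarrow> Q w = c - a * t\<^sup>2" if "t \<in> Fq q" "w \<in> V'" for t w
            unfolding Q_split[OF that] by (auto simp: algebra_simps)
          ultimately show ?thesis by metis
        qed
        then show "(\<lambda>(t, v). t * e + v) ` (SIGMA t:Fq q. {v \<in> V'. Q v = c - a * t\<^sup>2}) = {v \<in> V. Q v = c}"
          by (auto simp: image_iff)
      qed auto
      then show ?thesis by (simp add: bij_betw_same_card[symmetric] N'_def)
    qed
    have "e \<notin> V'" using Pee a two_neq_0 by (simp add: V'_def)
    then have "V' \<noteq> V" using e by blast
    then have "card V' < card V" by (intro psubset_card_mono) (auto simp: V'_def)
    moreover have "0 \<in> V'" using less.prems P_scale[OF Fq_0, of e 0] by (simp add: V'_def)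
    moreover have "\<And>x y. x \<in> V' \<Longrightarrow> y \<in> V' \<Longrightarrow> x + y \<in> V'"
      using less.prems by (simp add: V'_def P_add)
    moreover have "\<And>c x. c \<in> Fq q \<Longrightarrow> x \<in> V' \<Longrightarrow> c * x \<in> V'"
      using less.prems by (simp add: V'_def P_scale)
    ultimately obtain k W where W: "W \<subseteq> V'" "0 \<in> W" "card V' = q ^ k * card W"
      "\<forall>w\<in>W. \<forall>v\<in>V'. P w v = 0"
      and IH: "\<forall>c\<in>Fq q. if even k then N' (\<xi> * c) = N' c
        else q * (N' (\<xi> * c) + N' c) = 2 * card V'"
      using less.hyps[of V'] unfolding N'_def by blast
    have rad: "P w v = 0" if wv: "w \<in> W" "v \<in> V" for w v
    proof -
      obtain t v' where v: "v = t * e + v'" "t \<in> Fq q" "v' \<in> V'"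
        using wv(2) unfolding bij_betw_imp_surj_on[OF split, symmetric] by auto
      have "P w e = 0" using wv(1) W(1) by (auto simp: V'_def P_sym[of w])
      then show ?thesis using W(4) wv(1) v by (simp add: P_add P_scale)
    qed
    have total: "(\<Sum>u\<in>Fq q. N' (c - a * u)) = card V'" if "c \<in> Fq q" for c
    proof -
      have "(\<Sum>u\<in>Fq q. N' (c - a * u)) = (\<Sum>u\<in>Fq q. N' u)"
        by (rule sum.reindex_bij_witness[of _ "\<lambda>u. (c - u) / a" "\<lambda>u. c - a * u"])
          (use that a in \<open>auto intro!: Fq_diff Fq_mult Fq_divide\<close>)
      also have "\<dots> = card (\<Union>u\<in>Fq q. {v \<in> V'. Q v = u})"
        unfolding N'_def by (rule card_UN_disjoint[symmetric]) auto
      also have "(\<Union>u\<in>Fq q. {v \<in> V'. Q v = u}) = V'" using Q_Fq by auto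
      finally show ?thesis .
    qed
    \<comment> \<open>Since \<open>\<xi> * (c - a * t\<^sup>2) = \<xi> * c - a * (\<xi> *
      t\<^sup>2)\<close>, the two counts together let \<open>u\<close> in
      \<open>N' (\<xi> * c - a * u)\<close> run over the squares and over their \<xi>-multiples,
      meeting each \<open>u\<close> twice.\<close>
    have key: "card {v \<in> V. Q v = \<xi> * c} + (\<Sum>t\<in>Fq q. N' (\<xi> * (c - a * t\<^sup>2))) = 2 * card V'"
      if "c \<in> Fq q" for c
      using sum_squares_nonsquares[OF \<xi>, of "\<lambda>u. N' (\<xi> * c - a * u)"] total[of "\<xi> * c"] that \<xi>(1)
      by (simp add: N Fq_mult algebra_simps)
    have arg: "c - a * t\<^sup>2 \<in> Fq q" if "c \<in> Fq q" "t \<in> Fq q" for c t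
      using that a by (simp add: power2_eq_square Fq_mult Fq_diff)
    \<comment> \<open>One more dimension flips the parity. For even \<open>k\<close> the hypothesis
      removes \<xi> from the sum in \<open>key\<close>, which gives the odd rule because
      \<open>card V = q * card V'\<close>. For odd \<open>k\<close>, summing the hypothesis over
      \<open>t\<close> gives the same total \<open>2 * card V'\<close> with the count for
      \<open>c\<close> in place of that for \<open>\<xi> * c\<close>, so both counts agree.\<close>
    have step: "if even (Suc k) then card {v \<in> V. Q v = \<xi> * c} = card {v \<in> V. Q v = c}
       else q * (card {v \<in> V. Q v = \<xi> * c} + card {v \<in> V. Q v = c}) = 2 * card V"
      if c: "c \<in> Fq q" for c
    proof (cases "even k")
      case True
      then have "(\<Sum>t\<in>Fq q. N' (\<xi> * (c - a * t\<^sup>2))) = (\<Sum>t\<in>Fq q. N' (c - a * t\<^sup>2))"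
        using IH arg[OF c] by (intro sum.cong) auto
      then show ?thesis using True key[OF c] N[of c] cardV by simp
    next
      case False
      then have "(\<Sum>t\<in>Fq q. q * (N' (\<xi> * (c - a * t\<^sup>2)) + N' (c - a * t\<^sup>2))) = (\<Sum>t\<in>(Fq q :: 'a set). 2 * card V')"
        using IH arg[OF c] by (intro sum.cong) auto
      then have "q * ((\<Sum>t\<in>Fq q. N' (\<xi> * (c - a * t\<^sup>2))) + (\<Sum>t\<in>Fq q. N' (c - a * t\<^sup>2))) = q * (2 * card V')"
        by (simp add: card_Fq sum.distrib flip: sum_distrib_left)
      then have "(\<Sum>t\<in>Fq q. N' (\<xi> * (c - a * t\<^sup>2))) + (\<Sum>t\<in>Fq q. N' (c - a * t\<^sup>2)) = 2 * card V'"
        using q_ge by (simp only: mult_cancel1) simp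
      then show ?thesis using False key[OF c] N[of c] by simp
    qed
    have "W \<subseteq> V" using W(1) by (auto simp: V'_def)
    moreover have "card V = q ^ Suc k * card W" using cardV W(3) by simp
    ultimately show ?thesis using W(2) rad step
      by (intro exI[of _ "Suc k"] exI[of _ W]) blast
  qed
qed

text \<open>For \<open>x\<close> in the radical, moving the Frobenius power off \<open>y\<close>
  under the trace gives \<open>Tr q n (y * z) = 0\<close> for all \<open>y\<close>, where
  \<open>z = c * x ^ (q ^ j) + ?s c * ?s x\<close>. Hence \<open>z = 0\<close>, and taking norms
  equates \<open>Nq q n c * Nq q n x\<close> with its negative. So the radical is trivial, the rank
  is \<open>n\<close>, and the odd rule at 0 counts the zeros.\<close>

lemma card_trace_form_zeros:
  assumes \<xi>: "\<xi> \<in> Fq q" "\<not> (\<exists>y\<in>Fq q. y\<^sup>2 = (\<xi>::'a))" and c: "c \<noteq> (0::'a)" and j: "j \<le> n"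
  shows "card {y. Tr q n (c * (y * y ^ (q ^ j))) = 0} = q ^ (n - 1)"
proof -
  define Q where "Q y = Tr q n (c * (y * y ^ (q ^ j)))" for y
  define P where "P x y = Tr q n (c * (x * y ^ (q ^ j) + y * x ^ (q ^ j)))" for x y
  have "\<exists>k W. W \<subseteq> UNIV \<and> 0 \<in> W \<and> card (UNIV :: 'a set) = q ^ k * card W \<and> (\<forall>w\<in>W. \<forall>v\<in>UNIV. P w v = 0) \<and>
    (\<forall>c\<in>Fq q. if even k then card {v \<in> UNIV. Q v = \<xi> * c} = card {v \<in> UNIV. Q v = c}
       else q * (card {v \<in> UNIV. Q v = \<xi> * c} + card {v \<in> UNIV. Q v = c}) = 2 * card (UNIV :: 'a set))"
  proof (rule quadratic_form_representations[OF \<xi>])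
    show "Q (x + y) = Q x + Q y + P x y" for x y
      unfolding Q_def P_def by (simp add: frob_add algebra_simps flip: Tr_add)
    show "Q (a * x) = a\<^sup>2 * Q x" if "a \<in> Fq q" for a x
    proof -
      have "a\<^sup>2 \<in> Fq q" using that by (simp add: power2_eq_square Fq_mult)
      then show ?thesis unfolding Q_def
        by (subst Tr_scale[symmetric]) (simp_all add: power_mult_distrib Fq_frob[OF that] power2_eq_square ac_simps)
    qed
    show "Q x \<in> Fq q" for x unfolding Q_def by (rule Tr_in_Fq)
    show "P x (y + z) = P x y + P x z" for x y z
      unfolding P_def by (simp add: frob_add algebra_simps flip: Tr_add)
    show "P x (a * y) = a * P x y" if "a \<in> Fq q" for a x y
      unfolding P_def Tr_scale[OF that, symmetric]
      by (simp add: power_mult_distrib Fq_frob[OF that] algebra_simps)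
  qed simp_all
  then have "\<exists>k W. 0 \<in> W \<and> q ^ n = q ^ k * card W \<and> (\<forall>w\<in>W. \<forall>v. P w v = 0) \<and>
    (\<forall>c\<in>Fq q. if even k then card {v. Q v = \<xi> * c} = card {v. Q v = c}
       else q * (card {v. Q v = \<xi> * c} + card {v. Q v = c}) = 2 * q ^ n)"
    unfolding card_UNIV_eq by (simp only: UNIV_I ball_UNIV simp_thms subset_UNIV)
  then obtain k W where kW: "0 \<in> W" "q ^ n = q ^ k * card W" "\<forall>w\<in>W. \<forall>v. P w v = 0"
    and rep: "\<forall>c\<in>Fq q. if even k then card {v. Q v = \<xi> * c} = card {v. Q v = c}
       else q * (card {v. Q v = \<xi> * c} + card {v. Q v = c}) = 2 * q ^ n"
    by blast
  have "x = 0" if "x \<in> W" for x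
  proof (rule ccontr)
    assume x: "x \<noteq> 0"
    let ?s = "\<lambda>z::'a. z ^ (q ^ (n - j))"
    have "Tr q n (y * (c * x ^ (q ^ j) + ?s c * ?s x)) = 0" for y
    proof -
      have "?s (y ^ (q ^ j)) = y" using j by (simp add: frob_frob)
      then have "?s (c * (x * y ^ (q ^ j))) = y * (?s c * ?s x)"
        by (simp add: power_mult_distrib ac_simps)
      then have "Tr q n (c * (x * y ^ (q ^ j))) = Tr q n (y * (?s c * ?s x))"
        by (metis Tr_frob)
      then have "P x y = Tr q n (y * (c * x ^ (q ^ j) + ?s c * ?s x))"
        unfolding P_def by (simp add: distrib_left Tr_add ac_simps)
      then show ?thesis using kW(3) that by simp
    qed
    then have "c * x ^ (q ^ j) + ?s c * ?s x = 0" using Tr_nondegenerate by blast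
    then have "c * x ^ (q ^ j) = - (?s c * ?s x)" by (simp add: eq_neg_iff_add_eq_0)
    then have "Nq q n (c * x ^ (q ^ j)) = Nq q n (- (?s c * ?s x))" by simp
    then have "Nq q n c * Nq q n x = - (Nq q n c * Nq q n x)"
      by (simp only: Nq_minus Nq_mult Nq_frob)
    then show False using c x by (simp add: eq_minus_iff)
  qed
  then have "W = {0}" using kW(1) by blast
  then have "q ^ n = q ^ k" using kW(2) by simp
  then have "k = n" using q_ge power_inject_exp[of q n k] by simp
  then have "q * (card {v. Q v = 0} + card {v. Q v = 0}) = 2 * q ^ n"
    using rep[rule_format, OF Fq_0] odd_n by simp
  then have "2 * (q * card {v. Q v = 0}) = 2 * q ^ n" by (simp only: mult_2 distrib_left)
  moreover have "q ^ n = q * q ^ (n - 1)" using n_ge by (simp flip: power_Suc)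
  ultimately show ?thesis using q_ge by (simp add: Q_def)
qed

end

subsection \<open>Linearized polynomials\<close>

locale finite_field_generator = finite_field_ext q n ty
  for q n :: nat and ty :: "'a::{field,finite} itself" +
  fixes k :: nat
  assumes k_pos: "0 < k" and k_less: "k < n" and coprime_k: "coprime k n"
begin

abbreviation sg :: "'a \<Rightarrow> 'a" where "sg x \<equiv> x ^ (q ^ k)"
abbreviation si :: "'a \<Rightarrow> 'a" where "si x \<equiv> x ^ (q ^ (n - k))"

text \<open>With \<open>k = r mod n\<close>, \<open>sg\<close> is \<open>x \<mapsto> x ^ (q ^ r)\<close>, \<open>si\<close> is its inverse and \<open>A \<beta>\<close> is \<open>A_map q n \<beta> r\<close>.\<close>

definition A :: "'a \<Rightarrow> 'a \<Rightarrow> 'a" where "A \<beta> y = sg y - \<beta> * si y"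

lemma sg_si [simp]: "sg (si x) = x"
  using k_less by (simp add: frob_frob)

lemma coprime_k': "coprime (n - k) n"
proof -
  have "gcd (n - k) n = gcd k n"
    using k_less gcd_diff2_nat[of k n] by (simp add: gcd.commute)
  then show ?thesis using coprime_k by (simp add: coprime_iff_gcd_eq_1)
qed

lemma automorphism_fixing_sg: "automorphism_fixing q sg"
  by (rule automorphism_fixing_frob[OF coprime_k])

lemma automorphism_fixing_si: "automorphism_fixing q si"
  by (rule automorphism_fixing_frob[OF coprime_k'])

lemma si_eq_iff: "si x = x \<longleftrightarrow> x \<in> Fq q"
  using automorphism_fixing_si unfolding automorphism_fixing_def by blast

lemma sg_eq_iff: "sg x = x \<longleftrightarrow> x \<in> Fq q"
  using automorphism_fixing_sg unfolding automorphism_fixing_def by blast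

lemma A_add: "A \<beta> (x + y) = A \<beta> x + A \<beta> y"
  by (simp add: A_def frob_add algebra_simps)

lemma A_scale: "c \<in> Fq q \<Longrightarrow> A \<beta> (c * y) = c * A \<beta> y"
  by (simp add: A_def power_mult_distrib Fq_frob algebra_simps)

lemma A_0: "A \<beta> 0 = 0"
  using A_scale[OF Fq_0, of \<beta> 0] by simp

lemma A_scaling_iff:
  "A \<beta> (c * y) = c * A \<beta> y \<longleftrightarrow> sg (c - si c) * sg y = - \<beta> * (c - si c) * si y"
proof -
  have "A \<beta> (c * y) - c * A \<beta> y = sg (c - si c) * sg y - - \<beta> * (c - si c) * si y"
    by (simp add: A_def power_mult_distrib frob_diff algebra_simps)
  then show ?thesis by (metis eq_iff_diff_eq_0)
qed

lemma A_scaling_imp_Fq: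
  assumes "Nq q n \<beta> \<noteq> - 1" "y \<noteq> 0" "A \<beta> (c * y) = c * A \<beta> y"
  shows "c \<in> Fq q"
proof -
  let ?\<mu> = "c - si c"
  have "sg ?\<mu> * sg y = - (\<beta> * ?\<mu> * si y)" using assms(3) by (simp add: A_scaling_iff)
  then have "Nq q n (sg ?\<mu> * sg y) = Nq q n (- (\<beta> * ?\<mu> * si y))" by simp
  then have "Nq q n ?\<mu> * Nq q n y = - (Nq q n \<beta> * Nq q n ?\<mu> * Nq q n y)"
    by (simp only: Nq_minus Nq_mult Nq_frob)
  then have "Nq q n ?\<mu> * Nq q n y - - (Nq q n \<beta> * Nq q n ?\<mu> * Nq q n y) = 0"
    by (simp only: right_minus_eq)
  then have "Nq q n ?\<mu> * Nq q n y * (Nq q n \<beta> + 1) = 0" by (simp add: algebra_simps)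
  moreover have "Nq q n \<beta> + 1 \<noteq> 0" using assms(1) by (simp add: eq_neg_iff_add_eq_0)
  ultimately have "?\<mu> = 0" using assms(2) by simp
  then show ?thesis by (simp add: si_eq_iff[symmetric])
qed

end

section \<open>Power sums of the slopes of linearized polynomials\<close>

context finite_field_ext
begin

lemma of_nat_q: "of_nat q = (0::'a)"
proof -
  obtain e where e: "q = CHAR('a) ^ e" using q_power_CHAR by blast
  then have "e \<noteq> 0" using q_ge by (cases e) auto
  then have "CHAR('a) dvd q" unfolding e by (simp add: dvd_power)
  then show ?thesis by (simp add: of_nat_eq_0_iff_char_dvd)
qed

text \<open>For \<open>i = l\<close> there are \<open>q ^ n - 1\<close> terms equal to 1. Otherwise
  the root bound gives a nonzero \<open>z\<close> with \<open>z ^ i\<close> different from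
  \<open>z ^ l\<close>, and substituting \<open>z * x\<close> for \<open>x\<close> multiplies the
  sum by a factor other than 1.\<close>

lemma power_quotient_sum:
  assumes "i < q ^ n - 1" "l < q ^ n - 1"
  shows "(\<Sum>x\<in>UNIV - {0::'a}. x ^ i / x ^ l) = (if i = l then - 1 else 0)"
proof (cases "i = l")
  case True
  have "(\<Sum>x\<in>UNIV - {0::'a}. x ^ i / x ^ l) = (\<Sum>x\<in>UNIV - {0::'a}. 1)"
    using True by (intro sum.cong) auto
  also have "\<dots> = (\<Sum>x\<in>(UNIV::'a set). 1) - 1" by (subst sum.remove[of UNIV 0]) auto
  also have "(\<Sum>x\<in>(UNIV::'a set). 1) = (0::'a)"
    using n_ge by (simp add: card_UNIV_eq of_nat_q)
  finally show ?thesis using True by simp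
next
  case False
  have "card {x::'a. x ^ i = 1 * x ^ l} \<le> max i l"
  proof (cases "l < i")
    case True
    then show ?thesis using card_power_eq_le[OF True, of "1::'a"] by simp
  next
    case False
    then have "i < l" using \<open>i \<noteq> l\<close> by simp
    moreover have "{x::'a. x ^ i = 1 * x ^ l} = {x. x ^ l = 1 * x ^ i}" by auto
    ultimately show ?thesis using card_power_eq_le[of i l "1::'a"] by simp
  qed
  also have "\<dots> < card (UNIV - {0::'a})" using assms by (simp add: card_UNIV_eq)
  finally have "card {x::'a. x ^ i = x ^ l} < card (UNIV - {0::'a})" by simp
  then have "\<not> UNIV - {0} \<subseteq> {x::'a. x ^ i = x ^ l}" using card_mono[OF finite] by (metis leD)
  then obtain z :: 'a where z: "z \<noteq> 0" "z ^ i \<noteq> z ^ l" by blast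
  have "(\<Sum>x\<in>UNIV - {0::'a}. x ^ i / x ^ l) = (\<Sum>x\<in>UNIV - {0}. (z * x) ^ i / (z * x) ^ l)"
    by (rule sum.reindex_bij_witness[of _ "\<lambda>x. z * x" "\<lambda>x. x / z"]) (use z in auto)
  also have "\<dots> = z ^ i / z ^ l * (\<Sum>x\<in>UNIV - {0::'a}. x ^ i / x ^ l)"
    by (simp add: power_mult_distrib sum_distrib_left)
  finally have "(z ^ i / z ^ l - 1) * (\<Sum>x\<in>UNIV - {0::'a}. x ^ i / x ^ l) = 0"
    by (simp add: algebra_simps)
  moreover have "z ^ i / z ^ l - 1 \<noteq> 0" using z by simp
  ultimately have "(\<Sum>x\<in>UNIV - {0::'a}. x ^ i / x ^ l) = 0" by (meson mult_eq_0_iff)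
  then show ?thesis using False by simp
qed

lemma q_power_add_eq_iff:
  assumes "0 < j"
  shows "q ^ i + q ^ l = 1 + q ^ j \<longleftrightarrow> (i = 0 \<and> l = j) \<or> (i = j \<and> l = 0)"
proof
  assume eq: "q ^ i + q ^ l = 1 + q ^ j"
  have "i = 0 \<or> l = 0"
  proof (rule ccontr)
    assume "\<not> (i = 0 \<or> l = 0)"
    then have "q dvd q ^ i + q ^ l" by (simp add: dvd_power)
    moreover have "q dvd q ^ j" using assms by (simp add: dvd_power)
    ultimately have "q dvd 1" unfolding eq by (metis dvd_add_left_iff)
    then show False using q_ge by simp
  qed
  moreover have "q ^ x = q ^ y \<longleftrightarrow> x = y" for x y using q_ge by simp
  ultimately show "(i = 0 \<and> l = j) \<or> (i = j \<and> l = 0)" using eq by auto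
qed auto

text \<open>Keeps the exponents in the range where \<open>power_quotient_sum\<close> applies;
  \<open>q \<ge> 3\<close> leaves room for two summands.\<close>

lemma two_q_powers_less:
  assumes "i < n" "l < n"
  shows "q ^ i + q ^ l < q ^ n - 1"
proof -
  have "q ^ i \<le> q ^ (n - 1)" "q ^ l \<le> q ^ (n - 1)"
    using assms q_ge by (auto intro!: power_increasing)
  moreover have "q ^ n = q * q ^ (n - 1)" using n_ge by (simp flip: power_Suc)
  moreover have "q * q ^ (n - 1) \<ge> 3 * q ^ (n - 1)" using q_ge by simp
  moreover have "q ^ (n - 1) \<ge> q ^ 1" using n_ge q_ge by (intro power_increasing) auto
  then have "q ^ (n - 1) \<ge> q" by simp
  ultimately show ?thesis using q_ge by linarith
qed

lemma sum_linearized_quotient: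
  fixes f :: "nat \<Rightarrow> 'a"
  defines "F \<equiv> \<lambda>x. \<Sum>i<n. f i * x ^ (q ^ i)"
  shows "(\<Sum>x\<in>UNIV - {0}. F x / x) = - f 0"
proof -
  have "(\<Sum>x\<in>UNIV - {0}. F x / x) = (\<Sum>x\<in>UNIV - {0}. \<Sum>i<n. f i * (x ^ (q ^ i) / x ^ 1))"
    by (simp add: F_def sum_divide_distrib)
  also have "\<dots> = (\<Sum>i<n. f i * (\<Sum>x\<in>UNIV - {0}. x ^ (q ^ i) / x ^ 1))"
    by (subst sum.swap) (simp add: sum_distrib_left)
  also have "\<dots> = (\<Sum>i<n. f i * (if q ^ i = 1 then - 1 else 0))"
  proof (rule sum.cong)
    fix i assume "i \<in> {..<n}"
    then have "q ^ i < q ^ n - 1" "1 < q ^ n - 1"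
      using two_q_powers_less[of i 0] two_q_powers_less[of 0 0] n_ge by auto
    then show "f i * (\<Sum>x\<in>UNIV - {0}. x ^ (q ^ i) / x ^ 1) = f i * (if q ^ i = 1 then - 1 else 0)"
      by (subst power_quotient_sum) auto
  qed simp
  also have "\<dots> = (\<Sum>i<n. if i = 0 then - f i else 0)"
    using q_ge by (intro sum.cong) auto
  also have "\<dots> = - f 0" using n_ge by simp
  finally show ?thesis .
qed

text \<open>Expanding \<open>F x * F x ^ (q ^ j)\<close> gives the exponents
  \<open>q ^ i + q ^ ((l + j) mod n)\<close>, and only those equal to \<open>1 + q ^ j\<close>
  survive the summation. By reduction modulo \<open>q\<close> this leaves
  \<open>(i, l) = (0, 0)\<close> and \<open>(i, l) = (j, n - j)\<close>.\<close>

lemma sum_linearized_quotient_power: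
  fixes f :: "nat \<Rightarrow> 'a"
  defines "F \<equiv> \<lambda>x. \<Sum>i<n. f i * x ^ (q ^ i)"
  assumes j: "0 < j" "j < n"
  shows "(\<Sum>x\<in>UNIV - {0}. (F x / x) ^ (1 + q ^ j)) =
    - (f 0 * f 0 ^ (q ^ j) + f j * f (n - j) ^ (q ^ j))"
proof -
  define g where "g i l = f i * f l ^ (q ^ j)" for i l
  have "(F x / x) ^ (1 + q ^ j) =
      (\<Sum>i<n. \<Sum>l<n. g i l * (x ^ (q ^ i + q ^ ((l + j) mod n)) / x ^ (1 + q ^ j)))" for x
  proof -
    have "F x ^ (q ^ j) = (\<Sum>l<n. f l ^ (q ^ j) * x ^ (q ^ ((l + j) mod n)))"
      unfolding F_def frob_sum by (simp only: power_mult_distrib frob_frob frob_mod)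
    then have "F x * F x ^ (q ^ j) = (\<Sum>i<n. \<Sum>l<n. (f i * x ^ (q ^ i)) * (f l ^ (q ^ j) * x ^ (q ^ ((l + j) mod n))))"
      by (simp only: F_def sum_product)
    also have "\<dots> = (\<Sum>i<n. \<Sum>l<n. g i l * x ^ (q ^ i + q ^ ((l + j) mod n)))"
      by (simp add: g_def power_add ac_simps)
    finally show ?thesis
      by (simp add: power_divide sum_divide_distrib)
  qed
  then have "(\<Sum>x\<in>UNIV - {0}. (F x / x) ^ (1 + q ^ j)) =
      (\<Sum>x\<in>UNIV - {0}. \<Sum>i<n. \<Sum>l<n. g i l * (x ^ (q ^ i + q ^ ((l + j) mod n)) / x ^ (1 + q ^ j)))"
    by simp
  also have "\<dots> = (\<Sum>i<n. \<Sum>x\<in>UNIV - {0}. \<Sum>l<n. g i l * (x ^ (q ^ i + q ^ ((l + j) mod n)) / x ^ (1 + q ^ j)))"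
    by (rule sum.swap)
  also have "\<dots> = (\<Sum>i<n. \<Sum>l<n. \<Sum>x\<in>UNIV - {0}. g i l * (x ^ (q ^ i + q ^ ((l + j) mod n)) / x ^ (1 + q ^ j)))"
    by (intro sum.cong refl sum.swap)
  also have "\<dots> = (\<Sum>i<n. \<Sum>l<n. g i l * (\<Sum>x\<in>UNIV - {0}. x ^ (q ^ i + q ^ ((l + j) mod n)) / x ^ (1 + q ^ j)))"
    by (simp only: sum_distrib_left)
  also have "\<dots> = (\<Sum>i<n. \<Sum>l<n. (if i = 0 \<and> l = 0 then - g i l else 0) + (if i = j \<and> l = n - j then - g i l else 0))"
  proof (intro sum.cong refl)
    fix i l assume il: "i \<in> {..<n}" "l \<in> {..<n}"
    have m: "(l + j) mod n < n" using n_ge by simp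
    have "(l + j) mod n = j \<longleftrightarrow> l = 0" "(l + j) mod n = 0 \<longleftrightarrow> l = n - j"
      using il j by (auto simp: mod_if)
    then have "q ^ i + q ^ ((l + j) mod n) = 1 + q ^ j \<longleftrightarrow> (i = 0 \<and> l = 0) \<or> (i = j \<and> l = n - j)"
      by (simp only: q_power_add_eq_iff[OF j(1)])
    moreover have "q ^ i + q ^ ((l + j) mod n) < q ^ n - 1" "1 + q ^ j < q ^ n - 1"
      using two_q_powers_less[of i] two_q_powers_less[of 0 j] il m j n_ge by auto
    ultimately show "g i l * (\<Sum>x\<in>UNIV - {0}. x ^ (q ^ i + q ^ ((l + j) mod n)) / x ^ (1 + q ^ j)) =
      (if i = 0 \<and> l = 0 then - g i l else 0) + (if i = j \<and> l = n - j then - g i l else 0)"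
      using j by (subst power_quotient_sum) auto
  qed
  also have "\<dots> = (\<Sum>i<n. (if i = 0 then - g i 0 else 0) + (if i = j then - g i (n - j) else 0))"
  proof (intro sum.cong refl)
    fix i assume "i \<in> {..<n}"
    have "(\<Sum>l<n. (if i = 0 \<and> l = 0 then - g i l else 0)) = (if i = 0 then - g i 0 else 0)"
      using n_ge by (cases "i = 0") simp_all
    moreover have "(\<Sum>l<n. (if i = j \<and> l = n - j then - g i l else 0)) = (if i = j then - g i (n - j) else 0)"
      using j by (cases "i = j") simp_all
    ultimately show "(\<Sum>l<n. (if i = 0 \<and> l = 0 then - g i l else 0) + (if i = j \<and> l = n - j then - g i l else 0))
      = (if i = 0 then - g i 0 else 0) + (if i = j then - g i (n - j) else 0)"
      by (simp only: sum.distrib)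
  qed
  also have "\<dots> = - g 0 0 - g j (n - j)"
    using n_ge j by (simp add: sum.distrib)
  finally show ?thesis by (simp add: g_def)
qed

text \<open>The inverse of \<open>z \<mapsto> w1 * z + v1 * z ^ q\<close> is a geometric series in \<open>z \<mapsto> z ^ q\<close>; unless
  \<open>v1 = 0\<close> or \<open>w1 = 0\<close>, all its coefficients are nonzero.\<close>

lemma linearized_fraction:
  fixes w1 w2 v1 v2 :: 'a
  assumes det: "w1 * v2 \<noteq> w2 * v1"
    and inj: "\<And>z. w1 * z + v1 * z ^ q = 0 \<Longrightarrow> z = 0"
  obtains g where "\<And>z. (\<Sum>i<n. g i * (w1 * z + v1 * z ^ q) ^ (q ^ i)) = w2 * z + v2 * z ^ q"
    and "(g 1 = 0 \<or> g (n - 1) = 0) \<and> (\<forall>i. 2 \<le> i \<and> i \<le> n - 2 \<longrightarrow> g i = 0) \<or>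
      (\<forall>i. 0 < i \<and> i < n \<longrightarrow> g i \<noteq> 0)"
proof -
  consider "v1 = 0" | "w1 = 0" | "v1 \<noteq> 0" "w1 \<noteq> 0" by blast
  then show thesis
  proof cases
    case 1
    then have w1: "w1 \<noteq> 0" using det by auto
    define g where "g i = (if i = 0 then w2 / w1 else if i = 1 then v2 / w1 ^ q else 0)" for i :: nat
    have "(\<Sum>i<n. g i * (w1 * z + v1 * z ^ q) ^ (q ^ i)) = w2 * z + v2 * z ^ q" for z
    proof -
      have "(\<Sum>i<n. g i * (w1 * z + v1 * z ^ q) ^ (q ^ i)) = (\<Sum>i\<in>{0, 1}. g i * (w1 * z) ^ (q ^ i))"
        by (rule sum.mono_neutral_cong_right) (use 1 n_ge in \<open>auto simp: g_def\<close>)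
      then show ?thesis using w1 by (simp add: g_def power_mult_distrib)
    qed
    moreover have "g (n - 1) = 0" "\<forall>i. 2 \<le> i \<and> i \<le> n - 2 \<longrightarrow> g i = 0"
      using n_ge by (auto simp: g_def)
    ultimately show thesis using that by blast
  next
    case 2
    then have v1: "v1 \<noteq> 0" using det by auto
    define g where "g i = (if i = 0 then v2 / v1 else if i = n - 1 then w2 / v1 ^ (q ^ (n - 1)) else 0)" for i :: nat
    have "(\<Sum>i<n. g i * (w1 * z + v1 * z ^ q) ^ (q ^ i)) = w2 * z + v2 * z ^ q" for z
    proof -
      have "(z ^ q) ^ (q ^ (n - 1)) = z ^ (q ^ n)"
        using frob_frob[of z 1 "n - 1"] n_ge by simp
      then have z: "(z ^ q) ^ (q ^ (n - Suc 0)) = z" by simp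
      have "(\<Sum>i<n. g i * (w1 * z + v1 * z ^ q) ^ (q ^ i)) = (\<Sum>i\<in>{0, n - 1}. g i * (v1 * z ^ q) ^ (q ^ i))"
        by (rule sum.mono_neutral_cong_right) (use 2 n_ge in \<open>auto simp: g_def\<close>)
      then show ?thesis using v1 n_ge by (simp add: g_def power_mult_distrib z)
    qed
    moreover have "g 1 = 0" "\<forall>i. 2 \<le> i \<and> i \<le> n - 2 \<longrightarrow> g i = 0"
      using n_ge by (auto simp: g_def)
    ultimately show thesis using that by blast
  next
    case 3
    define \<kappa> where "\<kappa> = v1 / w1"
    define K where "K i = (\<Prod>m<i. \<kappa> ^ (q ^ m))" for i
    have \<kappa>: "\<kappa> \<noteq> 0" using 3 by (simp add: \<kappa>_def)
    have K0: "K i \<noteq> 0" for i using \<kappa> by (simp add: K_def)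
    \<comment> \<open>If \<kappa> had norm -1, Hilbert 90 would write \<open>- 1 / \<kappa>\<close>
      as \<open>z ^ q / z\<close>, and this \<open>z\<close> would violate
      \<open>inj\<close>.\<close>
    have N1: "1 + Nq q n \<kappa> \<noteq> 0"
    proof
      assume "1 + Nq q n \<kappa> = 0"
      then have N\<kappa>: "Nq q n \<kappa> = - 1" by (simp add: eq_neg_iff_add_eq_0 add.commute)
      have "Nq q n (- 1 / \<kappa>) = 1" unfolding Nq_divide Nq_minus N\<kappa> by simp
      then have "- 1 / \<kappa> \<in> (\<lambda>z. z ^ (q ^ 1) / z) ` (UNIV - {0})"
        using automorphism_quotients_eq_norm_1[OF automorphism_fixing_frob[of 1]] by simp
      then obtain z where z: "z \<noteq> 0" "- 1 / \<kappa> = z ^ q / z" by auto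
      then have "v1 * z ^ q = - (w1 * z)" using 3 by (simp add: \<kappa>_def field_simps)
      then have "w1 * z + v1 * z ^ q = 0" by simp
      then show False using inj z by blast
    qed
    \<comment> \<open>With \<open>x = w1 * z + v1 * z ^ q\<close>, the target equals
      \<open>v2 / v1 * x + (w2 - v2 * w1 / v1) * z\<close>. So only \<open>z\<close> remains to be
      expressed through \<open>x\<close>, which explains \<open>e\<close> and the extra constant
      coefficient of \<open>g\<close>.\<close>
    define e where "e = (w2 - v2 * w1 / v1) / (1 + Nq q n \<kappa>)"
    have "w2 - v2 * w1 / v1 \<noteq> 0" using 3 det by (simp add: field_simps)
    then have e: "e \<noteq> 0" using N1 by (simp add: e_def)
    \<comment> \<open>The signs and partial norms \<open>K i\<close> make the sum of
      \<open>c i * x ^ (q ^ i)\<close> telescope. As \<open>n\<close> is odd, the last term adds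
      \<open>Nq q n \<kappa> * z\<close> to \<open>z\<close>, which is the factor divided out in
      \<open>e\<close>.\<close>
    define c where "c i = (- 1) ^ i * K i / w1 ^ (q ^ i)" for i
    define g where "g i = (if i = 0 then v2 / v1 else 0) + e * c i" for i
    have "(\<Sum>i<n. g i * (w1 * z + v1 * z ^ q) ^ (q ^ i)) = w2 * z + v2 * z ^ q" for z
    proof -
      define x where "x = w1 * z + v1 * z ^ q"
      define T where "T i = (- 1) ^ i * K i * z ^ (q ^ i)" for i
      have "c i * x ^ (q ^ i) = T i - T (Suc i)" for i
      proof -
        have "x / w1 = z + \<kappa> * z ^ q" using 3 by (simp add: x_def \<kappa>_def field_simps)
        then have "(x / w1) ^ (q ^ i) = z ^ (q ^ i) + \<kappa> ^ (q ^ i) * z ^ (q ^ Suc i)"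
          using frob_frob[of z 1 i] by (simp add: frob_add power_mult_distrib)
        moreover have "K (Suc i) = K i * \<kappa> ^ (q ^ i)" by (simp add: K_def)
        moreover have "c i * x ^ (q ^ i) = (- 1) ^ i * K i * (x / w1) ^ (q ^ i)"
          by (simp add: c_def power_divide)
        ultimately show ?thesis by (simp add: T_def algebra_simps)
      qed
      then have "(\<Sum>i<n. c i * x ^ (q ^ i)) = T 0 - T n"
        by (simp add: sum_lessThan_telescope')
      also have "\<dots> = (1 + Nq q n \<kappa>) * z"
        using odd_n by (simp add: T_def K_def Nq_def algebra_simps)
      finally have z: "(\<Sum>i<n. c i * x ^ (q ^ i)) = (1 + Nq q n \<kappa>) * z" .
      have "(\<Sum>i<n. g i * x ^ (q ^ i)) = (\<Sum>i<n. (if i = 0 then v2 / v1 * x ^ (q ^ i) else 0)) + e * (\<Sum>i<n. c i * x ^ (q ^ i))"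
        unfolding sum_distrib_left sum.distrib[symmetric]
        by (intro sum.cong) (auto simp: g_def algebra_simps)
      also have "(\<Sum>i<n. (if i = 0 then v2 / v1 * x ^ (q ^ i) else 0)) = v2 / v1 * x"
        using n_ge by simp
      also have "e * (\<Sum>i<n. c i * x ^ (q ^ i)) = (w2 - v2 * w1 / v1) * z"
        unfolding z e_def using N1 by simp
      also have "v2 / v1 * x + (w2 - v2 * w1 / v1) * z = w2 * z + v2 * z ^ q"
        using 3 by (simp add: x_def field_simps)
      finally show ?thesis by (simp add: x_def)
    qed
    moreover have "\<forall>i. 0 < i \<and> i < n \<longrightarrow> g i \<noteq> 0"
      using e K0 3 by (simp add: g_def c_def)
    ultimately show thesis using that by blast
  qed
qed

end

context finite_field_generator
begin

text \<open>Equal slopes at \<open>z\<close> and \<open>y\<close> mean that \<open>z / y\<close> is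
  a scalar commuting with \<open>A \<beta>\<close> at \<open>y\<close>, hence lies in
  \<open>Fq q\<close>. The fibres have the same size as those of an automorphism quotient, which is
  what makes the power sums comparable.\<close>

lemma card_A_quotient_fibre:
  assumes "Nq q n \<beta> \<noteq> - 1" "y \<noteq> 0"
  shows "card {z \<in> UNIV - {0}. A \<beta> z / z = A \<beta> y / y} = q - 1"
proof -
  have "z / y \<in> Fq q" if "z \<noteq> 0" "A \<beta> z / z = A \<beta> y / y" for z
  proof (rule A_scaling_imp_Fq[OF assms])
    show "A \<beta> (z / y * y) = z / y * A \<beta> y"
      using that assms(2) by (simp add: field_simps)
  qed
  then have "bij_betw (\<lambda>c. c * y) (Fq q - {0}) {z \<in> UNIV - {0}. A \<beta> z / z = A \<beta> y / y}"
    using assms(2) by (intro bij_betw_byWitness[where f' = "\<lambda>x. x / y"]) (auto simp: A_scale)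
  then have "card {z \<in> UNIV - {0}. A \<beta> z / z = A \<beta> y / y} = card (Fq q - {0::'a})"
    by (rule bij_betw_same_card[symmetric])
  then show ?thesis using Fq_0 by (simp add: card_Fq)
qed

text \<open>The slopes \<open>\<rho> * \<tau> z / z\<close> exhaust a fibre of the norm whatever \<open>\<tau>\<close> is, so \<open>\<tau>\<close> may be
  replaced by \<open>z \<mapsto> z ^ q\<close>. Two linearized polynomials with the same slopes have the same
  power sums of slopes, hence the same values of \<open>f j * f (n - j) ^ (q ^ j)\<close>.\<close>

lemma A_slopes_not_pseudoregulus:
  assumes \<beta>: "\<beta> \<noteq> 0" "Nq q n \<beta> \<noteq> - 1" and n: "n > 3"
    and \<tau>: "automorphism_fixing q (\<tau> :: 'a \<Rightarrow> 'a)" and \<rho>: "\<rho> \<noteq> 0"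
    and det: "w1 * v2 \<noteq> w2 * v1"
    and H1: "\<And>z. z \<noteq> 0 \<Longrightarrow> \<exists>y c. y \<noteq> 0 \<and> c \<noteq> 0 \<and> z * w1 + \<rho> * \<tau> z * v1 = c * y \<and>
      z * w2 + \<rho> * \<tau> z * v2 = c * A \<beta> y"
    and H2: "\<And>y. y \<noteq> 0 \<Longrightarrow> \<exists>z c. z \<noteq> 0 \<and> c \<noteq> 0 \<and> z * w1 + \<rho> * \<tau> z * v1 = c * y \<and>
      z * w2 + \<rho> * \<tau> z * v2 = c * A \<beta> y"
  shows False
proof -
  let ?F = "UNIV - {0::'a}"
  define T where "T = {t. Nq q n t = Nq q n \<rho>}"
  have T_eq: "(\<lambda>z. \<rho> * (\<tau>' z / z)) ` ?F = T" if "automorphism_fixing q \<tau>'" for \<tau>'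
  proof -
    have "(\<lambda>z. \<rho> * (\<tau>' z / z)) ` ?F = (\<lambda>t. \<rho> * t) ` {x. Nq q n x = 1}"
      unfolding automorphism_quotients_eq_norm_1[OF that, symmetric] by (simp add: image_image)
    also have "\<dots> = T"
    proof (intro subset_antisym subsetI)
      fix t assume "t \<in> T"
      then have "Nq q n (t / \<rho>) = 1" using \<rho> by (simp add: T_def Nq_divide)
      moreover have "t = \<rho> * (t / \<rho>)" using \<rho> by simp
      ultimately show "t \<in> (\<lambda>t. \<rho> * t) ` {x. Nq q n x = 1}" by blast
    qed (auto simp: T_def Nq_mult)
    finally show ?thesis .
  qed
  define \<phi> :: "'a \<Rightarrow> 'a" where "\<phi> z = z ^ q" for z
  have \<phi>: "automorphism_fixing q \<phi>"
    using automorphism_fixing_frob[of 1] by (simp add: \<phi>_def[abs_def])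
  have den: "w1 + v1 * t \<noteq> 0" if "t \<in> T" for t
  proof -
    obtain z where z: "z \<noteq> 0" "t = \<rho> * (\<tau> z / z)" using \<open>t \<in> T\<close> T_eq[OF \<tau>] by blast
    obtain y c where "y \<noteq> 0" "c \<noteq> 0" "z * w1 + \<rho> * \<tau> z * v1 = c * y" using H1[OF z(1)] by blast
    moreover have "z * w1 + \<rho> * \<tau> z * v1 = z * (w1 + v1 * t)" using z by (simp add: field_simps)
    ultimately show ?thesis using z(1) by auto
  qed
  \<comment> \<open>The slope of \<open>z *s w + (\<rho> * \<tau> z) *s v\<close> depends only on
    \<open>t = \<rho> * (\<tau> z / z)\<close>, by a Moebius transformation. It has no pole on
    \<open>T\<close> by \<open>den\<close> and is injective there by \<open>det\<close>.\<close>
  define \<mu> where "\<mu> t = (w2 + v2 * t) / (w1 + v1 * t)" for t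
  have \<mu>_inj: "t = t'" if t: "t \<in> T" "t' \<in> T" and eq: "\<mu> t = \<mu> t'" for t t'
  proof -
    have "(w2 + v2 * t) * (w1 + v1 * t') = (w2 + v2 * t') * (w1 + v1 * t)"
      using eq den t by (simp add: \<mu>_def frac_eq_eq)
    then have "(w1 * v2 - w2 * v1) * (t - t') = 0" by (simp add: algebra_simps)
    then show ?thesis using det by simp
  qed
  have \<mu>_A: "\<mu> (\<rho> * (\<tau> z / z)) = A \<beta> y / y"
    if "z \<noteq> 0" "y \<noteq> 0" "c \<noteq> 0" "z * w1 + \<rho> * \<tau> z * v1 = c * y" "z * w2 + \<rho> * \<tau> z * v2 = c * A \<beta> y" for z y c
  proof -
    have "\<mu> (\<rho> * (\<tau> z / z)) = (z * (w2 + v2 * (\<rho> * (\<tau> z / z)))) / (z * (w1 + v1 * (\<rho> * (\<tau> z / z))))"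
      using that(1) by (simp add: \<mu>_def)
    also have "\<dots> = (z * w2 + \<rho> * \<tau> z * v2) / (z * w1 + \<rho> * \<tau> z * v1)"
      using that(1) by (simp add: distrib_left ac_simps)
    also have "\<dots> = A \<beta> y / y" unfolding that(4,5) using that(3) by simp
    finally show ?thesis .
  qed
  have M: "(\<lambda>y. A \<beta> y / y) ` ?F = \<mu> ` T"
  proof (intro subset_antisym subsetI)
    fix m assume "m \<in> \<mu> ` T"
    then obtain z where z: "z \<noteq> 0" "m = \<mu> (\<rho> * (\<tau> z / z))" using T_eq[OF \<tau>] by blast
    then show "m \<in> (\<lambda>y. A \<beta> y / y) ` ?F" using H1[OF z(1)] \<mu>_A by blast
  next
    fix m assume "m \<in> (\<lambda>y. A \<beta> y / y) ` ?F"
    then obtain y where y: "y \<noteq> 0" "m = A \<beta> y / y" by blast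
    then obtain z where "z \<noteq> 0" "m = \<mu> (\<rho> * (\<tau> z / z))" using H2[OF y(1)] \<mu>_A by metis
    then show "m \<in> \<mu> ` T" using T_eq[OF \<tau>] by blast
  qed
  have h_eq: "w1 * z + (\<rho> * v1) * z ^ q = z * (w1 + v1 * (\<rho> * (\<phi> z / z)))"
    "w2 * z + (\<rho> * v2) * z ^ q = z * (w2 + v2 * (\<rho> * (\<phi> z / z)))" if "z \<noteq> 0" for z
    using that by (simp_all add: \<phi>_def field_simps)
  have in_T: "\<rho> * (\<phi> z / z) \<in> T" if "z \<noteq> 0" for z using T_eq[OF \<phi>] that by blast
  have h0: "z = 0" if "w1 * z + (\<rho> * v1) * z ^ q = 0" for z
    using that h_eq(1)[of z] den in_T by (metis mult_eq_0_iff)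
  have det': "w1 * (\<rho> * v2) \<noteq> w2 * (\<rho> * v1)" using det \<rho> by (simp add: ac_simps)
  obtain g where g: "\<And>z. (\<Sum>i<n. g i * (w1 * z + (\<rho> * v1) * z ^ q) ^ (q ^ i)) = w2 * z + (\<rho> * v2) * z ^ q"
    and g_coeffs: "(g 1 = 0 \<or> g (n - 1) = 0) \<and> (\<forall>i. 2 \<le> i \<and> i \<le> n - 2 \<longrightarrow> g i = 0) \<or>
      (\<forall>i. 0 < i \<and> i < n \<longrightarrow> g i \<noteq> 0)"
    using linearized_fraction[OF det' h0] by blast
  define G where "G x = (\<Sum>i<n. g i * x ^ (q ^ i))" for x
  define h where "h z = w1 * z + (\<rho> * v1) * z ^ q" for z
  have "inj h"
  proof (rule injI)
    fix x y assume "h x = h y"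
    moreover have fd: "(x - y) ^ q = x ^ q - y ^ q" using frob_diff[of x y 1] by simp
    have "w1 * (x - y) + (\<rho> * v1) * (x - y) ^ q = h x - h y"
      unfolding h_def fd by (simp add: algebra_simps)
    ultimately have "w1 * (x - y) + (\<rho> * v1) * (x - y) ^ q = 0" by simp
    then have "x - y = 0" by (rule h0)
    then show "x = y" by simp
  qed
  then have "bij_betw h UNIV UNIV" by (simp add: finite_UNIV_inj_surj bij_def)
  moreover have "h 0 = 0" using q_ge by (simp add: h_def)
  ultimately have h_bij: "bij_betw h ?F ?F"
    using bij_betw_DiffI[of h UNIV UNIV "{0}" "{0}"] by (simp add: bij_betw_def)
  \<comment> \<open>Both sides are \<open>q - 1\<close> times the sum of \<Phi> over the common set
    of slopes. On the right the slopes are parametrized with \<open>\<phi>\<close> instead of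
    \<tau>, and the bijection \<open>h\<close> turns the fraction into the linearized polynomial
    \<open>G\<close> divided by \<open>x\<close>.\<close>
  have sums: "(\<Sum>y\<in>?F. \<Phi> (A \<beta> y / y)) = (\<Sum>x\<in>?F. \<Phi> (G x / x))" for \<Phi> :: "'a \<Rightarrow> 'a"
  proof -
    have "(\<Sum>y\<in>?F. \<Phi> (A \<beta> y / y)) = of_nat (q - 1) * (\<Sum>m\<in>\<mu> ` T. \<Phi> m)"
      unfolding M[symmetric]
      by (rule sum_comp_fibres) (use card_A_quotient_fibre[OF \<beta>(2)] in auto)
    also have "\<mu> ` T = (\<lambda>z. \<mu> (\<rho> * (\<phi> z / z))) ` ?F"
      unfolding T_eq[OF \<phi>, symmetric] by (simp add: image_image)
    also have "of_nat (q - 1) * (\<Sum>m\<in>\<dots>. \<Phi> m) = (\<Sum>z\<in>?F. \<Phi> (\<mu> (\<rho> * (\<phi> z / z))))"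
    proof (rule sum_comp_fibres[symmetric])
      fix x assume x: "x \<in> ?F"
      have "\<mu> (\<rho> * (\<phi> z / z)) = \<mu> (\<rho> * (\<phi> x / x)) \<longleftrightarrow> \<phi> z / z = \<phi> x / x" if "z \<in> ?F" for z
      proof
        assume "\<mu> (\<rho> * (\<phi> z / z)) = \<mu> (\<rho> * (\<phi> x / x))"
        then have "\<rho> * (\<phi> z / z) = \<rho> * (\<phi> x / x)"
          by (rule \<mu>_inj[OF in_T in_T, rotated 2]) (use x that in auto)
        then show "\<phi> z / z = \<phi> x / x" using \<rho> by (simp only: mult_cancel_left) blast
      qed (simp only:)
      then have "{z \<in> ?F. \<mu> (\<rho> * (\<phi> z / z)) = \<mu> (\<rho> * (\<phi> x / x))} = {z \<in> ?F. \<phi> z / z = \<phi> x / x}"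
        by blast
      then show "card {z \<in> ?F. \<mu> (\<rho> * (\<phi> z / z)) = \<mu> (\<rho> * (\<phi> x / x))} = q - 1"
        using card_automorphism_quotient_fibre[OF \<phi>] x by simp
    qed simp
    also have "\<dots> = (\<Sum>z\<in>?F. \<Phi> (G (h z) / h z))"
    proof (rule sum.cong)
      fix z assume "z \<in> ?F"
      then have z: "z \<noteq> 0" by simp
      have "G (h z) = w2 * z + (\<rho> * v2) * z ^ q" unfolding G_def h_def by (rule g)
      then have "G (h z) / h z = \<mu> (\<rho> * (\<phi> z / z))"
        unfolding h_eq(2)[OF z] unfolding h_def h_eq(1)[OF z] \<mu>_def using z by simp
      then show "\<Phi> (\<mu> (\<rho> * (\<phi> z / z))) = \<Phi> (G (h z) / h z)" by simp
    qed simp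
    also have "\<dots> = (\<Sum>x\<in>?F. \<Phi> (G x / x))"
      by (rule sum.reindex_bij_betw[OF h_bij])
    finally show ?thesis .
  qed
  define f where "f i = (if i = k then 1 else if i = n - k then - \<beta> else 0)" for i :: nat
  have k_neq: "k \<noteq> n - k" using odd_n k_less by presburger
  have A_eq: "A \<beta> y = (\<Sum>i<n. f i * y ^ (q ^ i))" for y
  proof -
    have "(\<Sum>i<n. f i * y ^ (q ^ i)) = (\<Sum>i\<in>{k, n - k}. f i * y ^ (q ^ i))"
      by (rule sum.mono_neutral_right) (use k_pos k_less in \<open>auto simp: f_def\<close>)
    then show ?thesis using k_neq by (simp add: f_def A_def)
  qed
  have "f 0 = g 0"
    using sums[of id] sum_linearized_quotient[of f] sum_linearized_quotient[of g]
    by (simp add: A_eq G_def)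
  then have coeff: "f j * f (n - j) ^ (q ^ j) = g j * g (n - j) ^ (q ^ j)" if j: "0 < j" "j < n" for j
    using sums[of "\<lambda>x. x ^ (1 + q ^ j)"] sum_linearized_quotient_power[OF j, of f]
      sum_linearized_quotient_power[OF j, of g]
    unfolding A_eq G_def by simp
  show False
    using g_coeffs
  proof
    assume *: "(g 1 = 0 \<or> g (n - 1) = 0) \<and> (\<forall>i. 2 \<le> i \<and> i \<le> n - 2 \<longrightarrow> g i = 0)"
    \<comment> \<open>At \<open>j = k\<close> the product is nonzero, so neither \<open>g k\<close>
      nor \<open>g (n - k)\<close> may vanish. Yet one of them does if \<open>k\<close> is 1 or
      \<open>n - 1\<close>, and both do otherwise.\<close>
    have "f k * f (n - k) ^ (q ^ k) \<noteq> 0" using \<beta>(1) k_neq by (simp add: f_def)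
    then have "g k \<noteq> 0" "g (n - k) \<noteq> 0" using coeff[OF k_pos k_less] q_ge by auto
    moreover have "k = 1 \<or> k = n - 1 \<or> (2 \<le> k \<and> k \<le> n - 2)" using k_pos k_less by linarith
    ultimately show False using * n_ge by auto
  next
    assume *: "\<forall>i. 0 < i \<and> i < n \<longrightarrow> g i \<noteq> 0"
    \<comment> \<open>As \<open>n\<close> is odd and above 3, some positive index avoids both
      \<open>k\<close> and \<open>n - k\<close>: 2 if these are 1 and \<open>n - 1\<close>, and 1
      otherwise.\<close>
    define j where "j = (if k = 1 \<or> k = n - 1 then 2 else 1 :: nat)"
    have j: "0 < j" "j < n" "j \<noteq> k" "j \<noteq> n - k"
      using n odd_n k_pos k_less by (auto simp: j_def)
    then have "f j = 0" by (simp add: f_def)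
    then show False using coeff[OF j(1,2)] * j by simp
  qed
qed

end

subsection \<open>The linear set\<close>

lemma vector4_eq_iff:
  "(vector [x, y, z, w] :: 'a::zero ^ 4) = vector [x', y', z', w'] \<longleftrightarrow> x = x' \<and> y = y' \<and> z = z' \<and> w = w'"
  by (simp add: vec_eq_iff forall_4 vector_4)

lemma vector4_add:
  "(vector [x, y, z, w] :: 'a::monoid_add ^ 4) + vector [x', y', z', w'] = vector [x + x', y + y', z + z', w + w']"
  by (simp add: vec_eq_iff forall_4 vector_4)

lemma vector4_scale:
  "c *s (vector [x, y, z, w] :: 'a::semiring_1 ^ 4) = vector [c * x, c * y, c * z, c * w]"
  by (simp add: vec_eq_iff forall_4 vector_4)

lemma vector4_zero: "(vector [0, 0, 0, 0] :: 'a::zero ^ 4) = 0"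
  by (simp add: vec_eq_iff forall_4 vector_4)

lemma vector4_eta: "(u :: 'a::zero ^ 4) = vector [u $ 1, u $ 2, u $ 3, u $ 4]"
  by (simp add: vec_eq_iff forall_4 vector_4)

lemma span_singleton_eq_imp_scale:
  fixes u v :: "'a::field ^ 'm"
  assumes "vec.span {u} = vec.span {v}" "u \<noteq> 0"
  obtains c where "c \<noteq> 0" "u = c *s v"
proof -
  have "u \<in> vec.span {v}" using assms(1) vec.span_base by blast
  then obtain c where "u = c *s v" unfolding span_singleton_eq by blast
  then show thesis using that assms(2) by (metis vec.scale_zero_left)
qed

locale linear_set_AB = finite_field_generator q n ty k
  for q n :: nat and ty :: "'a::{field,finite} itself" and k :: nat +
  fixes b \<xi> :: 'a
  assumes b_neq_0: "b \<noteq> 0" and Nq_b: "Nq q n b \<noteq> 1"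
    and \<xi>_Fq: "\<xi> \<in> Fq q" and \<xi>_nonsquare: "\<not> (\<exists>y\<in>Fq q. y\<^sup>2 = \<xi>)"
begin

lemma si_0: "si 0 = 0"
  using q_ge by simp

lemma \<xi>_neq_0: "\<xi> \<noteq> 0"
  using \<xi>_nonsquare Fq_0 by force

definition H :: "'a \<Rightarrow> 'a" where "H u = u - b * si u"

text \<open>\<open>V u y\<close> is the vector of \<open>U_AB q n r b \<xi>\<close> with \<open>x = H u\<close>.\<close>

definition V :: "'a \<Rightarrow> 'a \<Rightarrow> 'a ^ 4" where
  "V u y = vector [H u, y, A (b\<^sup>2) y, \<xi> * (u + b * si u)]"

definition UAB :: "('a ^ 4) set" where "UAB = {V u y | u y. True}"

lemma H_add: "H (u + v) = H u + H v"
  by (simp add: H_def frob_add algebra_simps)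

lemma H_scale: "c \<in> Fq q \<Longrightarrow> H (c * u) = c * H u"
  by (simp add: H_def power_mult_distrib Fq_frob algebra_simps)

lemma H_eq_0_iff: "H u = 0 \<longleftrightarrow> u = 0"
proof
  assume "H u = 0"
  then have "Nq q n u = Nq q n (b * si u)" by (simp add: H_def)
  then have "Nq q n u = Nq q n b * Nq q n u" by (simp only: Nq_mult Nq_frob)
  then show "u = 0" using Nq_b by simp
next
  assume "u = 0"
  then show "H u = 0" using H_scale[OF Fq_0, of 0] by simp
qed

lemma bij_H: "bij H"
proof -
  have "u = v" if "H u = H v" for u v
  proof -
    have "H (u - v) + H v = H u" unfolding H_add[symmetric] by simp
    then have "H (u - v) = 0" using that by simp
    then show ?thesis by (simp add: H_eq_0_iff)
  qed
  then have "inj H" by (rule injI)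
  then show ?thesis by (simp add: bij_def finite_UNIV_inj_surj)
qed

lemma V_add: "V u y + V u' y' = V (u + u') (y + y')"
  by (simp add: V_def vector4_add H_add A_add frob_add algebra_simps)

lemma V_scale: "c \<in> Fq q \<Longrightarrow> c *s V u y = V (c * u) (c * y)"
  by (simp add: V_def vector4_scale H_scale A_scale power_mult_distrib Fq_frob algebra_simps)

lemma V_0: "V 0 0 = 0"
  using V_scale[OF Fq_0, of 0 0] by simp

lemma V_inject: "V u y = V u' y' \<longleftrightarrow> u = u' \<and> y = y'"
  using bij_H by (auto simp: V_def vector4_eq_iff bij_def dest: injD)

lemma V_eq_0_iff: "V u y = 0 \<longleftrightarrow> u = 0 \<and> y = 0"
  using V_inject[of u y 0 0] by (simp add: V_0)

lemma V_in_U: "V u y \<in> UAB"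
  by (auto simp: UAB_def)

lemma UAB_E:
  assumes "x \<in> UAB"
  obtains u y where "x = V u y"
  using assms unfolding UAB_def by blast

lemma Fq_subspace_U: "Fq_subspace q UAB"
  unfolding Fq_subspace_def
proof (intro conjI ballI)
  show "0 \<in> UAB" using V_in_U[of 0 0] by (simp add: V_0)
  show "x + z \<in> UAB" if "x \<in> UAB" "z \<in> UAB" for x z
    using that by (elim UAB_E) (simp add: V_add V_in_U)
  show "c *s x \<in> UAB" if "c \<in> Fq q" "x \<in> UAB" for c x
    using that by (elim UAB_E) (simp add: V_scale V_in_U)
qed

lemma card_V_image: "card ((\<lambda>(u, y). V u y) ` S) = card S"
  by (rule card_image) (auto simp: inj_on_def V_inject)

lemma card_U: "card UAB = q ^ (2 * n)"
proof -
  have "UAB = (\<lambda>(u, y). V u y) ` UNIV" by (auto simp: UAB_def)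
  then have "card UAB = card (UNIV :: ('a \<times> 'a) set)" by (simp add: card_V_image)
  also have "\<dots> = q ^ n * q ^ n" by (simp add: card_UNIV_eq flip: UNIV_Times_UNIV)
  finally show ?thesis by (simp add: power_add mult_2)
qed

text \<open>Adding the first coordinate to the last one divided by \<xi> isolates
  \<open>2 * u'\<close>, so \<open>u' = c * u\<close>. What remains of the last coordinate is
  \<open>b * si u * (si c - c) = 0\<close>, and the two middle coordinates give the equation for
  \<open>A\<close>.\<close>

lemma scale_V_in_U_iff:
  "c *s V u y \<in> UAB \<longleftrightarrow> (u = 0 \<or> c \<in> Fq q) \<and> A (b\<^sup>2) (c * y) = c * A (b\<^sup>2) y"
proof
  assume "c *s V u y \<in> UAB"
  then obtain u' y' where "c *s V u y = V u' y'" by (auto simp: UAB_def)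
  then have eqs: "c * H u = H u'" "c * y = y'" "c * A (b\<^sup>2) y = A (b\<^sup>2) y'"
    "c * (\<xi> * (u + b * si u)) = \<xi> * (u' + b * si u')"
    by (auto simp: V_def vector4_scale vector4_eq_iff)
  have "\<xi> * (c * (u + b * si u)) = \<xi> * (u' + b * si u')"
    using eqs(4) by (simp only: ac_simps)
  then have eq4: "c * (u + b * si u) = u' + b * si u'"
    using \<xi>_neq_0 by (simp only: mult_cancel_left) blast
  have "2 * u' = H u' + (u' + b * si u')" by (simp add: H_def)
  also have "\<dots> = 2 * (c * u)"
    unfolding eqs(1)[symmetric] eq4[symmetric] by (simp add: H_def algebra_simps)
  finally have u': "u' = c * u" using two_neq_0 by (simp only: mult_cancel_left) blast
  have "b * si u * (si c - c) = (u' + b * si u') - c * (u + b * si u)"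
    unfolding u' by (simp add: power_mult_distrib algebra_simps)
  then have "b * si u * (si c - c) = 0" using eq4 by simp
  then have "u = 0 \<or> si c = c" using b_neq_0 by auto
  then show "(u = 0 \<or> c \<in> Fq q) \<and> A (b\<^sup>2) (c * y) = c * A (b\<^sup>2) y"
    using eqs(2,3) by (simp add: si_eq_iff)
next
  assume *: "(u = 0 \<or> c \<in> Fq q) \<and> A (b\<^sup>2) (c * y) = c * A (b\<^sup>2) y"
  show "c *s V u y \<in> UAB"
  proof (cases "c \<in> Fq q")
    case True
    then show ?thesis by (simp add: V_scale V_in_U)
  next
    case False
    then have "u = 0" using * by blast
    moreover have "H 0 = 0" by (simp add: H_eq_0_iff)
    ultimately have "c *s V u y = V 0 (c * y)"
      using * by (simp add: V_def vector4_scale si_0)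
    then show ?thesis by (simp add: V_in_U)
  qed
qed

lemma linear_set_U: "linear_set UAB = {vec.span {V u y} | u y. u \<noteq> 0 \<or> y \<noteq> 0}"
proof (intro subset_antisym subsetI)
  fix P assume "P \<in> linear_set UAB"
  then obtain x where x: "x \<in> UAB" "x \<noteq> 0" "P = vec.span {x}" unfolding linear_set_def by blast
  from x(1) obtain u y where "x = V u y" by (rule UAB_E)
  then show "P \<in> {vec.span {V u y} | u y. u \<noteq> 0 \<or> y \<noteq> 0}" using x V_eq_0_iff by blast
next
  fix P assume "P \<in> {vec.span {V u y} | u y. u \<noteq> 0 \<or> y \<noteq> 0}"
  then obtain u y where "P = vec.span {V u y}" "u \<noteq> 0 \<or> y \<noteq> 0" by blast
  then show "P \<in> linear_set UAB"
    unfolding linear_set_def using V_eq_0_iff[of u y] V_in_U[of u y] by blast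
qed

lemma weight_U_iff:
  assumes "u \<noteq> 0 \<or> y \<noteq> 0"
  shows "weight q UAB (vec.span {V u y}) = m \<longleftrightarrow>
    card {c. (u = 0 \<or> c \<in> Fq q) \<and> A (b\<^sup>2) (c * y) = c * A (b\<^sup>2) y} = q ^ m"
  using weight_eq_iff[OF Fq_subspace_U, of "V u y" m] assms
  by (auto simp: V_eq_0_iff scale_V_in_U_iff)

lemma scaling_set_Fq:
  assumes "u \<noteq> 0 \<or> y \<noteq> 0" "u \<noteq> 0 \<or> Nq q n (b\<^sup>2) \<noteq> - 1"
  shows "{c. (u = 0 \<or> c \<in> Fq q) \<and> A (b\<^sup>2) (c * y) = c * A (b\<^sup>2) y} = Fq q"
proof (intro subset_antisym subsetI)
  fix c assume c: "c \<in> {c. (u = 0 \<or> c \<in> Fq q) \<and> A (b\<^sup>2) (c * y) = c * A (b\<^sup>2) y}"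
  show "c \<in> Fq q"
  proof (cases "u = 0")
    case True
    then show ?thesis using A_scaling_imp_Fq[of "b\<^sup>2" y c] assms c by simp
  next
    case False
    then show ?thesis using c by simp
  qed
qed (simp add: A_scale)

lemma weight_U_eq_1:
  assumes "u \<noteq> 0 \<or> y \<noteq> 0" "u \<noteq> 0 \<or> Nq q n (b\<^sup>2) \<noteq> - 1"
  shows "weight q UAB (vec.span {V u y}) = 1"
  by (simp add: weight_U_iff[OF assms(1)] scaling_set_Fq[OF assms] card_Fq)

lemma maximum_scattered_U:
  assumes "Nq q n (b\<^sup>2) \<noteq> - 1"
  shows "maximum_scattered q n UAB"
  unfolding maximum_scattered_def scattered_def
proof (intro conjI ballI)
  fix P assume "P \<in> linear_set UAB"
  then obtain u y where "P = vec.span {V u y}" "u \<noteq> 0 \<or> y \<noteq> 0"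
    unfolding linear_set_U by blast
  then show "weight q UAB P = 1" using weight_U_eq_1 assms by simp
qed (simp_all add: Fq_subspace_U Fq_dim_eq_iff card_U)

section \<open>The two distinguished lines\<close>

lemma line_X1_X2_eq: "line_X1_X2 = vec.span {vector [1, 0, 0, 0], vector [0, 0, 0, 1] :: 'a ^ 4}"
proof -
  have "(u :: 'a ^ 4) \<in> line_X1_X2 \<longleftrightarrow> u \<in> {c *s vector [1, 0, 0, 0] + d *s vector [0, 0, 0, 1] | c d. True}" for u
    by (subst (2) vector4_eta[of u])
      (auto simp: line_X1_X2_def vector4_scale vector4_add vector4_eq_iff)
  then show ?thesis unfolding span_pair_eq by blast
qed

lemma line_X0_X3_eq: "line_X0_X3 = vec.span {vector [0, 1, 0, 0], vector [0, 0, 1, 0] :: 'a ^ 4}"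
proof -
  have "(u :: 'a ^ 4) \<in> line_X0_X3 \<longleftrightarrow> u \<in> {c *s vector [0, 1, 0, 0] + d *s vector [0, 0, 1, 0] | c d. True}" for u
    by (subst (2) vector4_eta[of u])
      (auto simp: line_X0_X3_def vector4_scale vector4_add vector4_eq_iff)
  then show ?thesis unfolding span_pair_eq by blast
qed

lemma is_line_X1_X2: "is_line (line_X1_X2 :: ('a ^ 4) set)"
  and is_line_X0_X3: "is_line (line_X0_X3 :: ('a ^ 4) set)"
  unfolding line_X1_X2_eq line_X0_X3_eq
  by (rule is_line_spanI,
    simp add: vector4_scale vector4_add vector4_eq_iff flip: vector4_zero)+

lemma V_in_line_X1_X2_iff: "V u y \<in> line_X1_X2 \<longleftrightarrow> y = 0"
  by (auto simp: line_X1_X2_def V_def vector_4 A_0)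

lemma V_in_line_X0_X3_iff: "V u y \<in> line_X0_X3 \<longleftrightarrow> u = 0"
  using q_ge by (auto simp: line_X0_X3_def V_def vector_4 H_eq_0_iff)

lemma long_line_X1_X2: "long_line q n UAB line_X1_X2"
proof -
  have "line_X1_X2 \<inter> UAB = (\<lambda>(u, y). V u y) ` (UNIV \<times> {0})"
    using V_in_line_X1_X2_iff by (auto simp: UAB_def)
  then have "card (line_X1_X2 \<inter> UAB) = q ^ n"
    by (simp only: card_V_image card_cartesian_product card_UNIV_eq) simp
  then show ?thesis by (simp add: long_line_iff[OF Fq_subspace_U] is_line_X1_X2)
qed

lemma long_line_X0_X3: "long_line q n UAB line_X0_X3"
proof -
  have "line_X0_X3 \<inter> UAB = (\<lambda>(u, y). V u y) ` ({0} \<times> UNIV)"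
    using V_in_line_X0_X3_iff by (auto simp: UAB_def)
  then have "card (line_X0_X3 \<inter> UAB) = q ^ n"
    by (simp only: card_V_image card_cartesian_product card_UNIV_eq) simp
  then show ?thesis by (simp add: long_line_iff[OF Fq_subspace_U] is_line_X0_X3)
qed

lemma span_singleton_subset_line_iff:
  "is_line l \<Longrightarrow> vec.span {v :: 'a ^ 4} \<subseteq> l \<longleftrightarrow> v \<in> l"
  unfolding is_line_def by (meson insert_subset subset_trans vec.span_minimal vec.span_superset empty_subsetI)

lemma points_on_line_X1_X2:
  "points_on (linear_set UAB) line_X1_X2 = {vec.span {V u 0} | u. u \<noteq> 0}"
  unfolding points_on_def linear_set_U
  using span_singleton_subset_line_iff[OF is_line_X1_X2] V_in_line_X1_X2_iff by auto

lemma points_on_line_X0_X3: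
  "points_on (linear_set UAB) line_X0_X3 = {vec.span {V 0 y} | y. y \<noteq> 0}"
  unfolding points_on_def linear_set_U
  using span_singleton_subset_line_iff[OF is_line_X0_X3] V_in_line_X0_X3_iff by auto

lemma V_left: "V u 0 = u *s vector [1, 0, 0, \<xi>] + (b * si u) *s vector [- 1, 0, 0, \<xi>]"
  by (simp add: V_def H_def A_0 vector4_scale vector4_add vector4_eq_iff algebra_simps)

lemma pseudoregulus_type_line_X1_X2:
  "pseudoregulus_type_line q (linear_set UAB) line_X1_X2"
proof -
  let ?w = "vector [1, 0, 0, \<xi>] :: 'a ^ 4" and ?v = "vector [- 1, 0, 0, \<xi>] :: 'a ^ 4"
  have "c = 0 \<and> d = 0" if "c *s ?w + d *s ?v = 0" for c d
  proof -
    have "c * 1 + d * - 1 = 0" "c * \<xi> + d * \<xi> = 0"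
      using that unfolding vector4_scale vector4_add vector4_zero[symmetric] vector4_eq_iff by blast+
    then have "c = d" "(2 * c) * \<xi> = 0" by (simp_all add: algebra_simps)
    then have "c = d" "2 * c = 0" using \<xi>_neq_0 by simp_all
    then show ?thesis using two_neq_0 by simp
  qed
  then have "?w \<noteq> ?v \<and> vec.independent {?w, ?v}" unfolding independent_pair_iff by blast
  moreover have "?w \<in> line_X1_X2" "?v \<in> line_X1_X2" by (simp_all add: line_X1_X2_def vector_4)
  moreover have "points_on (linear_set UAB) line_X1_X2 = {vec.span {z *s ?w + (b * si z) *s ?v} | z. z \<noteq> 0}"
    unfolding points_on_line_X1_X2 V_left ..
  ultimately show ?thesis
    unfolding pseudoregulus_type_line_def
    using is_line_X1_X2 b_neq_0 automorphism_fixing_si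
    by (intro conjI bexI[of _ ?w] bexI[of _ ?v] exI[of _ b] exI[of _ "\<lambda>x. si x"]) simp_all
qed

lemma not_pseudoregulus_type_line_X0_X3:
  assumes N: "Nq q n (b\<^sup>2) \<noteq> - 1" and n: "n > 3"
  shows "\<not> pseudoregulus_type_line q (linear_set UAB) line_X0_X3"
proof
  assume "pseudoregulus_type_line q (linear_set UAB) line_X0_X3"
  then obtain w v \<rho> \<tau> where wv: "w \<in> line_X0_X3" "v \<in> line_X0_X3" "w \<noteq> v \<and> vec.independent {w, v}"
    and \<rho>: "\<rho> \<noteq> 0" and \<tau>: "automorphism_fixing q \<tau>"
    and pts: "points_on (linear_set UAB) line_X0_X3 = {vec.span {z *s w + (\<rho> * \<tau> z) *s v} | z. z \<noteq> 0}"
    unfolding pseudoregulus_type_line_def by blast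
  obtain w1 w2 where w: "w = vector [0, w1, w2, 0]"
    using wv(1) vector4_eta[of w] unfolding line_X0_X3_def by fastforce
  obtain v1 v2 where v: "v = vector [0, v1, v2, 0]"
    using wv(2) vector4_eta[of v] unfolding line_X0_X3_def by fastforce
  have indep: "c = 0" "d = 0" if "c *s w + d *s v = 0" for c d
    using wv(3) that independent_pair_iff[of w v] by blast+
  have det: "w1 * v2 \<noteq> w2 * v1"
  proof
    assume eq: "w1 * v2 = w2 * v1"
    \<comment> \<open>A vanishing determinant makes these two relations hold; independence then
      kills both coordinates of \<open>w\<close>.\<close>
    have rels: "v2 *s w + (- w2) *s v = 0" "v1 *s w + (- w1) *s v = 0"
      unfolding w v vector4_scale vector4_add vector4_zero[symmetric] vector4_eq_iff
      using eq by (simp_all add: ac_simps)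
    have "w2 = 0" "w1 = 0" using indep(2)[OF rels(1)] indep(2)[OF rels(2)] by simp_all
    then have "1 *s w + 0 *s v = 0" by (simp add: w vector4_zero)
    from indep(1)[OF this] show False by simp
  qed
  have comb: "z *s w + (\<rho> * \<tau> z) *s v = vector [0, z * w1 + \<rho> * \<tau> z * v1, z * w2 + \<rho> * \<tau> z * v2, 0]" for z
    unfolding w v vector4_scale vector4_add by simp
  have V0: "c *s V 0 y = vector [0, c * y, c * A (b\<^sup>2) y, 0]" for c y
    using H_eq_0_iff[of 0] by (simp add: V_def vector4_scale si_0)
  have comb_neq_0: "z *s w + (\<rho> * \<tau> z) *s v \<noteq> 0" if "z \<noteq> 0" for z
    using indep(1)[of z "\<rho> * \<tau> z"] that by blast
  have rel: "\<exists>c. c \<noteq> 0 \<and> z * w1 + \<rho> * \<tau> z * v1 = c * y \<and> z * w2 + \<rho> * \<tau> z * v2 = c * A (b\<^sup>2) y"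
    if z: "z \<noteq> 0" and eq: "vec.span {z *s w + (\<rho> * \<tau> z) *s v} = vec.span {V 0 y}" for z y
  proof -
    obtain c where "c \<noteq> 0" "z *s w + (\<rho> * \<tau> z) *s v = c *s V 0 y"
      using span_singleton_eq_imp_scale[OF eq comb_neq_0[OF z]] by blast
    then show ?thesis unfolding comb V0 vector4_eq_iff by blast
  qed
  show False
  proof (rule A_slopes_not_pseudoregulus[OF _ N n \<tau> \<rho> det])
    show "b\<^sup>2 \<noteq> 0" using b_neq_0 by simp
    show "\<exists>y c. y \<noteq> 0 \<and> c \<noteq> 0 \<and> z * w1 + \<rho> * \<tau> z * v1 = c * y \<and> z * w2 + \<rho> * \<tau> z * v2 = c * A (b\<^sup>2) y"
      if z: "z \<noteq> 0" for z
    proof -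
      have "vec.span {z *s w + (\<rho> * \<tau> z) *s v} \<in> points_on (linear_set UAB) line_X0_X3"
        unfolding pts using z by blast
      then obtain y where "y \<noteq> 0" "vec.span {z *s w + (\<rho> * \<tau> z) *s v} = vec.span {V 0 y}"
        unfolding points_on_line_X0_X3 by blast
      then show ?thesis using rel[OF z] by blast
    qed
    show "\<exists>z c. z \<noteq> 0 \<and> c \<noteq> 0 \<and> z * w1 + \<rho> * \<tau> z * v1 = c * y \<and> z * w2 + \<rho> * \<tau> z * v2 = c * A (b\<^sup>2) y"
      if y: "y \<noteq> 0" for y
    proof -
      have "vec.span {V 0 y} \<in> points_on (linear_set UAB) line_X0_X3"
        unfolding points_on_line_X0_X3 using y by blast
      then obtain z where "z \<noteq> 0" "vec.span {V 0 y} = vec.span {z *s w + (\<rho> * \<tau> z) *s v}"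
        unfolding pts by blast
      then show ?thesis using rel[of z y] by metis
    qed
  qed
qed

lemma pseudoregulus_type_U:
  assumes N: "Nq q n (b\<^sup>2) \<noteq> - 1" and n: "n = 3"
  shows "pseudoregulus_type q n UAB"
proof -
  define \<beta> where "\<beta> = b\<^sup>2"
  have k: "k = 1 \<or> k = 2" using k_pos k_less n by auto
  have si_si_si: "si (si (si x)) = x" for x
  proof -
    have "si (si (si x)) = x ^ (q ^ ((n - k + (n - k) + (n - k)) mod n))"
      by (simp only: frob_frob frob_mod)
    also have "(n - k + (n - k) + (n - k)) mod n = 0" using n by presburger
    finally show ?thesis by simp
  qed
  have sg: "sg x = si (si x)" for x
    by (metis si_si_si sg_si)
  have Nq3: "Nq q n x = x * si x * si (si x)" for x
  proof -
    have three: "Nq q n x = x * x ^ q * x ^ (q ^ 2)"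
      by (simp add: Nq_def n lessThan_nat_numeral lessThan_Suc numeral_3_eq_3 numeral_2_eq_2 ac_simps)
    consider "k = 1" | "k = 2" using k by blast
    then show ?thesis
    proof cases
      case 1
      then show ?thesis using three sg[of x] n by (simp add: ac_simps)
    next
      case 2
      then show ?thesis using three sg[of x] n by (simp add: ac_simps)
    qed
  qed
  \<comment> \<open>These are the coefficient vectors of \<open>u\<close>, \<open>z\<close>,
    \<open>si u\<close> and \<open>si z\<close> in \<open>V u (\<psi> z)\<close>, with
    \<open>\<psi>\<close> as defined below. They bring \<open>UAB\<close> into the shape that
    \<open>pseudoregulus_lines_exist\<close> asks for, with \<open>si\<close> as the
    automorphism.\<close>
  define w1 w2 v1 v2 :: "'a ^ 4"
    where "w1 = vector [1, 0, 0, \<xi>]" and "w2 = vector [0, si \<beta>, 1, 0]"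
      and "v1 = vector [- b, 0, 0, \<xi> * b]" and "v2 = vector [0, 1, - \<beta> * si (si \<beta>), 0]"
  note w_defs = w1_def w2_def v1_def v2_def
  txt \<open>For \<open>n = 3\<close> the coordinates \<open>(\<psi> z, A \<beta> (\<psi> z))\<close> involve only \<open>z\<close> and \<open>si z\<close>: the coefficient \<open>si \<beta>\<close>
    is chosen so that the two terms in \<open>si (si z)\<close> cancel in \<open>A \<beta> (\<psi> z)\<close>.\<close>
  define \<psi> where "\<psi> z = si \<beta> * z + si z" for z
  have A_\<psi>: "A \<beta> (\<psi> z) = z - \<beta> * si (si \<beta>) * si z" for z
    by (simp add: A_def \<psi>_def frob_add power_mult_distrib sg si_si_si algebra_simps)
  have \<psi>0: "z = 0" if "\<psi> z = 0" for z
  proof (rule ccontr)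
    assume z: "z \<noteq> 0"
    have "si z = - (si \<beta> * z)" using that by (simp add: \<psi>_def eq_neg_iff_add_eq_0 add.commute)
    then have "Nq q n (si z) = Nq q n (- (si \<beta> * z))" by simp
    then have "Nq q n z = - (Nq q n \<beta> * Nq q n z)"
      by (simp only: Nq_frob Nq_minus Nq_mult)
    then have "(- Nq q n \<beta>) * Nq q n z = 1 * Nq q n z" by simp
    then have "- Nq q n \<beta> = 1" using z by (simp only: mult_cancel_right Nq_eq_0_iff) simp
    then have "Nq q n \<beta> = - 1" by (metis minus_minus)
    then show False using N by (simp add: \<beta>_def)
  qed
  have "inj \<psi>"
  proof (rule injI)
    fix x y assume "\<psi> x = \<psi> y"
    moreover have "\<psi> (x - y) = \<psi> x - \<psi> y" unfolding \<psi>_def frob_diff by (simp add: algebra_simps)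
    ultimately have "\<psi> (x - y) = 0" by simp
    then have "x - y = 0" by (rule \<psi>0)
    then show "x = y" by simp
  qed
  then have surj: "surj \<psi>" by (simp add: finite_UNIV_inj_surj)
  have V_eq: "V u (\<psi> z) = u *s w1 + z *s w2 + si u *s v1 + si z *s v2" for u z
    unfolding V_def \<beta>_def[symmetric] A_\<psi> w_defs vector4_scale vector4_add vector4_eq_iff
    by (simp add: H_def \<psi>_def algebra_simps)
  have U_eq: "UAB = {c *s w1 + d *s w2 + si c *s v1 + si d *s v2 | c d. True}"
    unfolding V_eq[symmetric] UAB_def using surj by (metis surjD)
  \<comment> \<open>The system splits into two blocks: coordinates 1 and 4 have determinant
    \<open>2 * b * \<xi>\<close>, and coordinates 2 and 3 have determinant
    \<open>1 + Nq q n \<beta>\<close> up to sign.\<close>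
  have indep: "c1 = 0 \<and> c2 = 0 \<and> d1 = 0 \<and> d2 = 0"
    if "c1 *s w1 + c2 *s w2 + d1 *s v1 + d2 *s v2 = 0" for c1 c2 d1 d2
  proof -
    have raw: "c1 * 1 + c2 * 0 + d1 * - b + d2 * 0 = 0" "c1 * \<xi> + c2 * 0 + d1 * (\<xi> * b) + d2 * 0 = 0"
      "c1 * 0 + c2 * si \<beta> + d1 * 0 + d2 * 1 = 0" "c1 * 0 + c2 * 1 + d1 * 0 + d2 * (- \<beta> * si (si \<beta>)) = 0"
      using that unfolding w_defs vector4_scale vector4_add vector4_zero[symmetric] vector4_eq_iff
      by blast+
    have c1: "c1 = d1 * b" using raw(1) by simp
    moreover have "\<xi> * (c1 + d1 * b) = 0" using raw(2) by (simp add: algebra_simps)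
    ultimately have "2 * c1 = 0" using \<xi>_neq_0 by auto
    then have "c1 = 0" using two_neq_0 by simp
    then have "d1 = 0" using c1 b_neq_0 by simp
    have d2: "d2 = - (c2 * si \<beta>)" using raw(3) by (simp add: eq_neg_iff_add_eq_0 add.commute)
    have eq: "c2 + d2 * (- \<beta> * si (si \<beta>)) = 0" using raw(4) by simp
    have "c2 * (1 + Nq q n \<beta>) = 0"
      using eq unfolding d2 Nq3 by (simp add: algebra_simps)
    moreover have "1 + Nq q n \<beta> \<noteq> 0" using N by (simp add: \<beta>_def eq_neg_iff_add_eq_0 add.commute)
    ultimately have "c2 = 0" by simp
    then show ?thesis using \<open>c1 = 0\<close> \<open>d1 = 0\<close> d2 by simp
  qed
  show ?thesis
    unfolding pseudoregulus_type_def
    using maximum_scattered_U[OF N]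
      pseudoregulus_lines_exist[OF automorphism_fixing_si indep U_eq Fq_subspace_U] by blast
qed

section \<open>Points of weight two and the size of the linear set\<close>

lemma card_scaling_set:
  assumes c0: "c0 \<noteq> 0" "sg c0 = - (b\<^sup>2) * c0" and y: "y \<noteq> 0"
  shows "card {c. A (b\<^sup>2) (c * y) = c * A (b\<^sup>2) y} =
    (if Tr q n (c0 * (inverse y * si (inverse y))) = 0 then q ^ 2 else q)"
proof -
  \<comment> \<open>This \<open>w\<close> is itself a nonzero solution \<mu> of
    \<open>sg \<mu> * sg y = - (b\<^sup>2) * \<mu> * si y\<close>. The quotient of any solution by
    \<open>w\<close> is fixed by \<open>sg\<close>, so the solutions are exactly the multiples of
    \<open>w\<close> by \<open>Fq q\<close>.\<close>
  define w where "w = c0 * (inverse y * si (inverse y))"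
  have w0: "w \<noteq> 0" using c0 y by (simp add: w_def)
  have "A (b\<^sup>2) (c * y) = c * A (b\<^sup>2) y \<longleftrightarrow> (c - si c) / w \<in> Fq q" for c
  proof -
    let ?\<mu> = "c - si c"
    have sgw: "sg w * (sg y * y) = - (b\<^sup>2) * c0"
      using y c0(2) by (simp add: w_def power_mult_distrib power_inverse field_simps)
    have wy: "w * (y * si y) = c0"
      using y by (simp add: w_def power_mult_distrib power_inverse field_simps)
    have "?\<mu> / w \<in> Fq q \<longleftrightarrow> sg ?\<mu> * w = ?\<mu> * sg w"
      unfolding sg_eq_iff[symmetric] power_divide using w0 by (simp add: frac_eq_eq)
    also have "\<dots> \<longleftrightarrow> (sg ?\<mu> * w) * (y * si y * sg y) = (?\<mu> * sg w) * (y * si y * sg y)"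
      using y by simp
    also have "(sg ?\<mu> * w) * (y * si y * sg y) = sg ?\<mu> * sg y * (w * (y * si y))"
      by (simp only: ac_simps)
    also have "(?\<mu> * sg w) * (y * si y * sg y) = ?\<mu> * si y * (sg w * (sg y * y))"
      by (simp only: ac_simps)
    also have "sg ?\<mu> * sg y * (w * (y * si y)) = ?\<mu> * si y * (sg w * (sg y * y)) \<longleftrightarrow>
        sg ?\<mu> * sg y * c0 = - (b\<^sup>2) * ?\<mu> * si y * c0"
      unfolding wy sgw by (simp only: ac_simps)
    also have "\<dots> \<longleftrightarrow> sg ?\<mu> * sg y = - (b\<^sup>2) * ?\<mu> * si y"
      using c0(1) by (simp only: mult_cancel_right) blast
    finally show ?thesis by (simp only: A_scaling_iff)
  qed
  moreover have "c - si c = t * w \<longleftrightarrow> (c - si c) / w = t" for c t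
    by (rule nonzero_divide_eq_eq[OF w0, symmetric])
  ultimately have "A (b\<^sup>2) (c * y) = c * A (b\<^sup>2) y \<longleftrightarrow> (\<exists>t\<in>Fq q. c - si c = t * w)" for c
    by (simp only: bex_triv_one_point2)
  then have "{c. A (b\<^sup>2) (c * y) = c * A (b\<^sup>2) y} = (\<Union>t\<in>Fq q. {c. c - si c = t * w})"
    by (simp only: UNION_eq mem_Collect_eq)
  also have "card \<dots> = (\<Sum>t\<in>Fq q. card {c. c - si c = t * w})"
    by (rule card_UN_disjoint) (use w0 in auto)
  \<comment> \<open>By the additive Hilbert 90, \<open>t * w\<close> has \<open>q\<close> preimages
    under \<open>c \<mapsto> c - si c\<close> if its trace \<open>t * Tr q n w\<close> vanishes, and
    none otherwise. Hence all \<open>t\<close> contribute, or only \<open>t = 0\<close>.\<close>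
  also have "\<dots> = (\<Sum>t\<in>(Fq q :: 'a set). if Tr q n w = 0 \<or> t = 0 then q else 0)"
  proof (rule sum.cong)
    fix t :: 'a assume t: "t \<in> Fq q"
    have Tr: "Tr q n (t * w) = t * Tr q n w" by (rule Tr_scale[OF t])
    show "card {c. c - si c = t * w} = (if Tr q n w = 0 \<or> t = 0 then q else 0)"
    proof (cases "Tr q n w = 0 \<or> t = 0")
      case True
      then have "Tr q n (t * w) = 0" unfolding Tr by auto
      then show ?thesis using True card_frob_diff_eq[OF coprime_k'] by simp
    next
      case False
      then have "Tr q n (t * w) \<noteq> 0" unfolding Tr by simp
      then have "c - si c \<noteq> t * w" for c using Tr_diff[of c "si c"] Tr_frob[of c "n - k"] by auto
      then show ?thesis using False by simp
    qed
  qed simp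
  also have "\<dots> = (if Tr q n w = 0 then q ^ 2 else q)"
    using Fq_0 by (simp add: card_Fq power2_eq_square)
  finally show ?thesis by (simp add: w_def)
qed

text \<open>The nonzero vectors on points of weight two are the \<open>V 0 y\<close> with
  \<open>y\<close> in \<open>Z\<close>, which gives the number of these points. Counting all
  \<open>q ^ (2 * n) - 1\<close> nonzero vectors then gives the number of points of weight
  one.\<close>

lemma linear_set_U_counts:
  assumes N: "Nq q n (b\<^sup>2) = - 1"
  defines "L \<equiv> linear_set UAB"
  shows "\<forall>P\<in>L. weight q UAB P > 1 \<longrightarrow> weight q UAB P = 2"
    and "real (card {P \<in> L. weight q UAB P > 1}) = (real q ^ (n - 1) - 1) / (real q ^ 2 - 1)"
    and "real (card L) = (real q ^ (2 * n + 1) + real q ^ (2 * n) - real q ^ n - 1) / (real q ^ 2 - 1)"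
proof -
  have "Nq q n (- (b\<^sup>2)) = 1" unfolding Nq_minus N by simp
  then have "- (b\<^sup>2) \<in> (\<lambda>z. sg z / z) ` (UNIV - {0})"
    using automorphism_quotients_eq_norm_1[OF automorphism_fixing_sg] by simp
  then obtain c0 where c0': "c0 \<noteq> 0" "- (b\<^sup>2) = sg c0 / c0" by blast
  have c0: "c0 \<noteq> 0" "sg c0 = - (b\<^sup>2) * c0" unfolding c0'(2) using c0'(1) by simp_all
  define Z where "Z = {y. y \<noteq> 0 \<and> Tr q n (c0 * (inverse y * si (inverse y))) = 0}"
  have weight_V: "weight q UAB (vec.span {V u y}) = (if u = 0 \<and> y \<in> Z then 2 else 1)"
    if uy: "u \<noteq> 0 \<or> y \<noteq> 0" for u y
  proof (cases "u = 0")
    case True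
    then show ?thesis using uy card_scaling_set[OF c0, of y]
      by (auto simp: weight_U_iff Z_def)
  next
    case False
    then show ?thesis using weight_U_eq_1[of u y] by simp
  qed
  have wt: "weight q UAB P = 1 \<or> weight q UAB P = 2" if P: "P \<in> L" for P
  proof -
    obtain u y where "P = vec.span {V u y}" "u \<noteq> 0 \<or> y \<noteq> 0"
      using P unfolding L_def linear_set_U by blast
    then show ?thesis using weight_V[of u y] by simp
  qed
  then show "\<forall>P\<in>L. weight q UAB P > 1 \<longrightarrow> weight q UAB P = 2" by fastforce
  define L2 where "L2 = {P \<in> L. weight q UAB P > 1}"
  have L2: "weight q UAB P = 2" if "P \<in> L2" for P using wt[of P] that by (auto simp: L2_def)
  have L1: "weight q UAB P = 1" if "P \<in> L - L2" for P using wt[of P] that by (auto simp: L2_def)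
  have card_P: "card (P \<inter> UAB) = q ^ weight q UAB P" if P: "P \<in> L" for P
  proof -
    have "vec.subspace P" using P unfolding L_def linear_set_def by auto
    then show ?thesis unfolding weight_def
      by (intro card_Fq_subspace Fq_subspace_Int Fq_subspace_U)
  qed
  have 0: "0 \<in> UAB" using V_in_U[of 0 0] by (simp add: V_0)
  have "{x \<in> UAB - {0}. vec.span {x} \<in> L2} = (\<lambda>(u, y). V u y) ` ({0} \<times> Z)"
  proof (intro subset_antisym subsetI)
    fix x assume x: "x \<in> {x \<in> UAB - {0}. vec.span {x} \<in> L2}"
    then obtain u y where xV: "x = V u y" by (auto elim: UAB_E)
    then have uy: "u \<noteq> 0 \<or> y \<noteq> 0" using x by (auto simp: V_eq_0_iff)
    have "weight q UAB (vec.span {V u y}) = 2" using x L2 unfolding xV by blast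
    then have "u = 0 \<and> y \<in> Z" using weight_V[OF uy] by (simp split: if_splits)
    then show "x \<in> (\<lambda>(u, y). V u y) ` ({0} \<times> Z)" using xV by auto
  next
    fix x assume "x \<in> (\<lambda>(u, y). V u y) ` ({0} \<times> Z)"
    then obtain y where y: "y \<in> Z" "x = V 0 y" by auto
    then have "y \<noteq> 0" by (simp add: Z_def)
    then have "x \<noteq> 0" using y by (simp add: V_eq_0_iff)
    moreover have "weight q UAB (vec.span {x}) = 2" using weight_V[of 0 y] y \<open>y \<noteq> 0\<close> by simp
    moreover have "vec.span {x} \<in> L"
      using \<open>x \<noteq> 0\<close> V_in_U[of 0 y] y(2) unfolding L_def linear_set_def by blast
    ultimately show "x \<in> {x \<in> UAB - {0}. vec.span {x} \<in> L2}"
      using y V_in_U by (simp add: L2_def)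
  qed
  then have "card {x \<in> UAB - {0}. vec.span {x} \<in> L2} = card Z"
    by (simp add: card_V_image card_cartesian_product)
  also have "\<dots> = q ^ (n - 1) - 1"
  proof -
    let ?Q = "{z. Tr q n (c0 * (z * si z)) = 0}"
    \<comment> \<open>The criterion for weight two evaluates the trace form at
      \<open>inverse y\<close>, so inversion matches \<open>Z\<close> with the nonzero zeros of the
      form.\<close>
    have "bij_betw inverse (?Q - {0}) Z"
      by (rule bij_betw_byWitness[where f' = inverse]) (auto simp: Z_def)
    then have "card Z = card (?Q - {0})" by (rule bij_betw_same_card[symmetric])
    moreover have "card ?Q = q ^ (n - 1)"
      by (rule card_trace_form_zeros[OF \<xi>_Fq \<xi>_nonsquare c0(1)]) simp
    moreover have "0 \<in> ?Q" by (simp add: Tr_scale[OF Fq_0, of 0, simplified])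
    ultimately show ?thesis by simp
  qed
  finally have "(\<Sum>P\<in>L2. card (P \<inter> UAB) - 1) = q ^ (n - 1) - 1"
    using sum_card_points[OF 0, of L2] by (simp add: L2_def L_def)
  moreover have "(\<Sum>P\<in>L2. card (P \<inter> UAB) - 1) = (\<Sum>P\<in>L2. q ^ 2 - 1)"
  proof (rule sum.cong)
    fix P assume P: "P \<in> L2"
    then have "P \<in> L" by (simp add: L2_def)
    then show "card (P \<inter> UAB) - 1 = q ^ 2 - 1" unfolding card_P[OF \<open>P \<in> L\<close>] L2[OF P] by simp
  qed simp
  ultimately have n2: "card L2 * (q ^ 2 - 1) = q ^ (n - 1) - 1" by simp
  have "{x \<in> UAB - {0}. vec.span {x} \<in> L} = UAB - {0}"
    unfolding L_def linear_set_def by blast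
  then have "(\<Sum>P\<in>L. card (P \<inter> UAB) - 1) = q ^ (2 * n) - 1"
    using sum_card_points[OF 0, of L] 0 by (simp add: L_def card_U)
  moreover have "(\<Sum>P\<in>L. card (P \<inter> UAB) - 1) =
      (\<Sum>P\<in>L2. card (P \<inter> UAB) - 1) + (\<Sum>P\<in>L - L2. card (P \<inter> UAB) - 1)"
    by (rule sum.subset_diff[THEN trans, OF _ _ add.commute]) (auto simp: L2_def)
  moreover have "(\<Sum>P\<in>L - L2. card (P \<inter> UAB) - 1) = (\<Sum>P\<in>L - L2. q - 1)"
  proof (rule sum.cong)
    fix P assume P: "P \<in> L - L2"
    then have "P \<in> L" by simp
    then show "card (P \<inter> UAB) - 1 = q - 1" unfolding card_P[OF \<open>P \<in> L\<close>] L1[OF P] by simp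
  qed simp
  ultimately have n1: "card (L - L2) * (q - 1) + (q ^ (n - 1) - 1) = q ^ (2 * n) - 1"
    using \<open>(\<Sum>P\<in>L2. card (P \<inter> UAB) - 1) = q ^ (n - 1) - 1\<close> by simp
  have cardL: "card L = card (L - L2) + card L2"
    using card_mono[of L L2] by (simp add: card_Diff_subset L2_def)
  have q1: "1 \<le> q ^ m" for m using q_ge by simp
  have r2: "real (card L2) * (real q ^ 2 - 1) = real q ^ (n - 1) - 1"
    using arg_cong[OF n2, of real] q1 by (simp add: of_nat_diff)
  have r1: "real (card (L - L2)) * (real q - 1) + (real q ^ (n - 1) - 1) = real q ^ (2 * n) - 1"
  proof -
    have "real (q ^ m - 1) = real q ^ m - 1" for m using q1 by (simp add: of_nat_diff)
    moreover have "real (q - 1) = real q - 1" using q_ge by (simp add: of_nat_diff)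
    ultimately show ?thesis
      using arg_cong[OF n1, of real] by (simp only: of_nat_add of_nat_mult)
  qed
  have r1': "real (card (L - L2)) * (real q - 1) = real q ^ (2 * n) - real q ^ (n - 1)"
    using r1 by simp
  have "real q ^ 2 > 1" using q_ge by (intro one_less_power) auto
  then have q2: "real q ^ 2 - 1 \<noteq> 0" by simp
  show "real (card {P \<in> L. weight q UAB P > 1}) = (real q ^ (n - 1) - 1) / (real q ^ 2 - 1)"
    using r2 q2 unfolding L2_def[symmetric] by (simp add: field_simps)
  have qn: "real q ^ n = real q * real q ^ (n - 1)" using n_ge by (simp flip: power_Suc)
  have "real (card L) * (real q ^ 2 - 1) =
      (real q + 1) * (real (card (L - L2)) * (real q - 1)) + real (card L2) * (real q ^ 2 - 1)"
    unfolding cardL by (simp add: power2_eq_square algebra_simps)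
  also have "\<dots> = (real q + 1) * (real q ^ (2 * n) - real q ^ (n - 1)) + (real q ^ (n - 1) - 1)"
    unfolding r1' r2 ..
  also have "\<dots> = real q ^ (2 * n + 1) + real q ^ (2 * n) - real q ^ n - 1"
    unfolding qn by (simp add: algebra_simps)
  finally show "real (card L) = (real q ^ (2 * n + 1) + real q ^ (2 * n) - real q ^ n - 1) / (real q ^ 2 - 1)"
    using q2 by (simp add: nonzero_eq_divide_eq)
qed

end

theorem theorem4p7:
  fixes q n :: nat and r :: int and b \<xi> :: "'a::{field,finite}"
  defines "U \<equiv> U_AB q n r b \<xi>"
  defines "L \<equiv> linear_set U"
  assumes "primepow q" and "odd q"
    and "n \<ge> 3" and "odd n"
    and "CARD('a) = q ^ n"
    and "\<xi> \<in> Fq q" and "\<not> (\<exists>y\<in>Fq q. y\<^sup>2 = \<xi>)"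
    and "gcd (int n) r = 1"
    and "b \<noteq> 0" and "Nq q n b \<noteq> 1" and "Nq q n b \<noteq> - 1"
  shows "(Nq q n (b\<^sup>2) \<noteq> - 1 \<and> n = 3 \<longrightarrow>
            maximum_scattered q n U \<and> pseudoregulus_type q n U) \<and>
         (Nq q n (b\<^sup>2) \<noteq> - 1 \<and> n > 3 \<longrightarrow>
            maximum_scattered q n U \<and>
            long_line q n U line_X1_X2 \<and> long_line q n U line_X0_X3 \<and>
            ((pseudoregulus_type_line q L line_X1_X2 \<and> \<not> pseudoregulus_type_line q L line_X0_X3) \<or>
             (pseudoregulus_type_line q L line_X0_X3 \<and> \<not> pseudoregulus_type_line q L line_X1_X2))) \<and>
         (Nq q n (b\<^sup>2) = - 1 \<longrightarrow>
            (\<forall>P\<in>L. weight q U P > 1 \<longrightarrow> weight q U P = 2) \<and>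
            real (card {P \<in> L. weight q U P > 1}) = (real q ^ (n - 1) - 1) / (real q ^ 2 - 1) \<and>
            real (card L) =
              (real q ^ (2 * n + 1) + real q ^ (2 * n) - real q ^ n - 1) / (real q ^ 2 - 1))"
proof -
  define k where "k = nat (r mod int n)"
  have int_k: "int k = r mod int n" using \<open>n \<ge> 3\<close> by (simp add: k_def)
  have "k < n" using \<open>n \<ge> 3\<close> int_k pos_mod_bound[of "int n" r] by linarith
  have "gcd (int k) (int n) = gcd r (int n)" by (simp add: int_k gcd.commute flip: gcd_red_int)
  then have "gcd (int k) (int n) = 1" using \<open>gcd (int n) r = 1\<close> by (simp add: gcd.commute)
  then have "gcd k n = 1" by (simp only: gcd_int_int_eq of_nat_eq_1_iff)
  then have "coprime k n" by (simp add: coprime_iff_gcd_eq_1)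
  moreover have "k \<noteq> 0" using \<open>coprime k n\<close> \<open>n \<ge> 3\<close> by (intro notI) simp
  ultimately interpret linear_set_AB q n "TYPE('a)" k b \<xi>
    by unfold_locales (use assms \<open>k < n\<close> in simp_all)
  \<comment> \<open>The residue of \<open>n - r\<close> is \<open>n - k\<close> because
    \<open>0 < k < n\<close>; thus \<open>frob\<close> at \<open>n - r\<close> is the inverse
    Frobenius power \<open>si\<close>.\<close>
  have "(int n - r) mod int n = (int n - r mod int n) mod int n" by (rule mod_diff_right_eq[symmetric])
  also have "\<dots> = int (n - k)"
    using \<open>k < n\<close> \<open>k \<noteq> 0\<close> mod_pos_pos_trivial[of "int n - int k" "int n"]
    by (simp only: int_k[symmetric])
  finally have frob: "frob q n r = sg" "frob q n (int n - r) = si"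
    by (simp_all add: frob_def fun_eq_iff k_def)
  have H_map: "H_map q n b r = H" by (simp add: H_map_def H_def fun_eq_iff frob)
  \<comment> \<open>Twice the inverse image \<open>u\<close> minus \<open>H u\<close> flips the sign
    of the \<open>b\<close>-term; this is why \<open>x = H u\<close> is the convenient
    parameter.\<close>
  have "B_map q n b r (H u) = u + b * si u" for u
    using bij_H by (simp add: B_map_def H_map bij_def inv_f_f) (simp add: H_def)
  then have vec_eq: "V u y = vector [H u, y, A_map q n (b\<^sup>2) r y, \<xi> * B_map q n b r (H u)]" for u y
    by (simp add: V_def A_map_def A_def frob)
  have "U_AB q n r b \<xi> = UAB"
    unfolding U_AB_def UAB_def vec_eq
  proof (intro subset_antisym subsetI)
    fix v assume "v \<in> {vector [x, y, A_map q n (b\<^sup>2) r y, \<xi> * B_map q n b r x] | x y. True}"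
    then obtain x y where v: "v = vector [x, y, A_map q n (b\<^sup>2) r y, \<xi> * B_map q n b r x]" by blast
    obtain u where "x = H u" using bij_is_surj[OF bij_H] by (rule surjE)
    then show "v \<in> {vector [H u, y, A_map q n (b\<^sup>2) r y, \<xi> * B_map q n b r (H u)] | u y. True}"
      using v by blast
  qed blast
  then have U_eq: "U = UAB" by (simp add: U_def)
  show ?thesis
    unfolding L_def U_eq
    using maximum_scattered_U pseudoregulus_type_U long_line_X1_X2 long_line_X0_X3
      pseudoregulus_type_line_X1_X2 not_pseudoregulus_type_line_X0_X3 linear_set_U_counts
    by blast
qed

end
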